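(* Let $K$ be a commutative ring with unit and $S$ an inverse semigroup. Then the semigroup algebra $KS$ has a unit if and only if $\widehat{E(S)}$ is compact. The center of $KS$, under the isomorphism $KS\cong K\mathscr G(S)$ given by $s\mapsto \chi_{(s,D(s^*s))}$, is the space of class functions on the universal groupoid $\mathscr G(S)$.
   Context: Rings with unit are assumed non-zero ($1\neq 0$). An inverse semigroup is a semigroup $S$ such that each $s\in S$ has a unique $s^*$ with $ss^*s=s$, $s^*ss^*=s^*$. $E(S)$ is its commutative semigroup of idempotents; $s\le t$ iff $s=et$ for some $e\in E(S)$. $KS$ is the semigroup algebra. Groupoid notation: $d(g)=g^{-1}g$, $r(g)=gg^{-1}$; $gh$ is defined iff $d(g)=r(h)$. "Compact" includes Hausdorff. Give $K$ the discrete topology. For an ample groupoid $\mathscr G$ (a topological groupoid, locally compact but not necessarily Hausdorff, with locally compact Hausdorff unit space $\mathscr G^0$, with $d$ a local homeomorphism to $\mathscr G^0$, and with a basis of compact open sets on which $d$ and $r$ are injective), $K\mathscr G$ is the $K$-module of functions $\mathscr G\to K$ spanned by those $f$ for which there is an open Hausdorff subspace $V$ such that $f$ vanishes outside $V$ and $f|_V$ is continuous with compact support. Its product is convolution $f\ast g(x)=\sum_{y\in d^{-1}(d(x))}f(xy^{-1})g(y)$. An $f\in K\mathscr G$ is a class function if (i) $f(x)\ne0$ implies $d(x)=r(x)$; and (ii) $d(x)=r(x)=d(z)$ implies $f(zxz^{-1})=f(x)$. $\widehat{E(S)}$ is the space of non-zero semilattice homomorphisms $\varphi\colon E(S)\to\{0,1\}$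 with the subspace topology from $\{0,1\}^{E(S)}$; $D(e)=\{\varphi\mid\varphi(e)=1\}$. Each $s\in S$ acts by the homeomorphism $D(s^*s)\to D(ss^* )$, $(s\varphi)(e)=\varphi(s^*es)$. The universal groupoid $\mathscr G(S)$ is the set of classes $[s,\varphi]$ of pairs $(s,\varphi)$ with $\varphi\in D(s^*s)$, where $(s,\varphi)\sim(t,\psi)$ iff $\varphi=\psi$ and there is $u\le s,t$ with $\varphi\in D(u^*u)$. It has as basis the sets $(s,U)=\{[s,\varphi]\mid\varphi\in U\}$ with $U\subseteq D(s^*s)$ open, product $[s,\varphi][t,\psi]=[st,\psi]$ defined iff $t\psi=\varphi$, inverse $[s,\varphi]^{-1}=[s^*,s\varphi]$, $d([s,\varphi])=\varphi$, $r([s,\varphi])=s\varphi$ (unit space identified with $\widehat{E(S)}$). It is an ample groupoid. The map $s\mapsto\chi_{(s,D(s^*s))}$ extends to a $K$-algebra isomorphism $KS\to K\mathscr G(S)$. *)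

theory Defs
  imports
    "HOL-Library.Poly_Mapping"
    "HOL-Library.Function_Algebras"
    "HOL-Library.Indicator_Function"
    "HOL-Analysis.Function_Topology"
    "HOL-Analysis.T1_Spaces"
begin

section \<open>Inverse semigroups\<close>

class inverse_semigroup = semigroup_mult +
  assumes ex1_star: "\<exists>!t. s * t * s = s \<and> t * s * t = t"

definition star :: "'s::inverse_semigroup \<Rightarrow> 's" where
  "star s = (THE t. s * t * s = s \<and> t * s * t = t)"

definition idems :: "'s::inverse_semigroup set" where
  "idems = {e. e * e = e}"

definition nat_le :: "'s::inverse_semigroup \<Rightarrow> 's \<Rightarrow> bool" where
  "nat_le s t \<longleftrightarrow> (\<exists>e\<in>idems. s = e * t)"


lemma star_props: "s * star s * s = s" "star s * s * star s = star s"
  using theI'[OF ex1_star[of s]] by (simp_all add: star_def)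

lemma star_unique: "s * t * s = s \<Longrightarrow> t * s * t = t \<Longrightarrow> star s = t"
  using ex1_star[of s] star_props[of s] by blast

lemma star_idem: "e \<in> idems \<Longrightarrow> star e = e"
  by (rule star_unique) (auto simp: idems_def)

lemma idems_mult:
  assumes "e \<in> idems" "f \<in> idems"
  shows "e * f \<in> idems"
proof -
  have ee: "e * e = e" "\<And>z. e * (e * z) = e * z" and ff: "f * f = f" "\<And>z. f * (f * z) = f * z"
    using assms by (simp_all add: idems_def flip: mult.assoc)
  let ?x = "star (e * f)"
  have p1: "e * (f * (?x * (e * f))) = e * f"
    using star_props(1)[of "e * f"] by (simp add: mult.assoc)
  have p2: "?x * (e * (f * ?x)) = ?x"
    using star_props(2)[of "e * f"] by (simp add: mult.assoc)
  have p2': "\<And>z. ?x * (e * (f * (?x * z))) = ?x * z"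
    by (metis p2 mult.assoc)
  have x: "?x = f * ?x * e"
    by (rule star_unique) (simp_all add: mult.assoc ee ff p1 p2')
  have "(f * ?x * e) * (f * ?x * e) = f * ?x * e"
    by (simp add: mult.assoc p2')
  then have "?x * ?x = ?x"
    by (simp flip: x)
  then have "star ?x = ?x"
    by (simp add: star_idem idems_def)
  moreover have "star ?x = e * f"
    by (rule star_unique) (simp_all add: star_props)
  ultimately have "?x = e * f" by simp
  then show ?thesis using \<open>?x * ?x = ?x\<close> by (simp add: idems_def)
qed

lemma idems_commute:
  assumes "e \<in> idems" "f \<in> idems"
  shows "e * f = f * e"
proof -
  have ee: "e * e = e" "\<And>z. e * (e * z) = e * z" and ff: "f * f = f" "\<And>z. f * (f * z) = f * z"
    using assms by (simp_all add: idems_def flip: mult.assoc)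
  have ef: "e * (f * (e * f)) = e * f" "f * (e * (f * e)) = f * e"
    using idems_mult[OF assms] idems_mult[OF assms(2,1)] by (simp_all add: idems_def mult.assoc)
  have "star (e * f) = f * e"
    by (rule star_unique) (simp_all add: mult.assoc ee ff ef)
  then show ?thesis
    using star_idem[OF idems_mult[OF assms]] by simp
qed

lemma star_mult_idems: "star s * s \<in> idems" "s * star s \<in> idems"
  by (simp_all add: idems_def star_props flip: mult.assoc)

lemma star_star: "star (star s) = s"
  by (rule star_unique) (simp_all add: star_props)

lemma star_mult: "star (s * t) = star t * star s"
proof (rule star_unique)
  have c: "(t * star t) * (star s * s) = (star s * s) * (t * star t)"
    by (rule idems_commute) (simp_all add: star_mult_idems)
  have "s * t * (star t * star s) * (s * t) = s * ((t * star t) * (star s * s)) * t"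
    by (simp add: mult.assoc)
  also have "\<dots> = (s * star s * s) * (t * star t * t)"
    by (subst c) (simp add: mult.assoc)
  finally show "s * t * (star t * star s) * (s * t) = s * t" by (simp add: star_props)
  have "star t * star s * (s * t) * (star t * star s) = star t * ((star s * s) * (t * star t)) * star s"
    by (simp add: mult.assoc)
  also have "\<dots> = (star t * t * star t) * (star s * s * star s)"
    by (subst c[symmetric]) (simp add: mult.assoc)
  finally show "star t * star s * (s * t) * (star t * star s) = star t * star s" by (simp add: star_props)
qed

lemma conj_idems:
  assumes "e \<in> idems"
  shows "star s * e * s \<in> idems"
proof -
  have c: "(s * star s) * e = e * (s * star s)"
    by (rule idems_commute) (simp_all add: assms star_mult_idems)
  have "(star s * e * s) * (star s * e * s) = star s * (e * ((s * star s) * e)) * s"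
    by (simp add: mult.assoc)
  also have "\<dots> = star s * (e * e) * (s * star s * s)"
    by (subst c) (simp add: mult.assoc)
  finally show ?thesis using assms by (simp add: star_props idems_def)
qed


section \<open>The semigroup algebra\<close>

text \<open>Elements of the semigroup algebra are the finitely supported functions. The multiplication
  of \<^theory>\<open>HOL-Library.Poly_Mapping\<close> convolves along an additive monoid of exponents, so the
  product along a multiplicative semigroup is defined here.\<close>

definition sa_scale :: "'k::comm_ring_1 \<Rightarrow> ('s \<Rightarrow>\<^sub>0 'k) \<Rightarrow> ('s \<Rightarrow>\<^sub>0 'k)" where
  "sa_scale c a = Poly_Mapping.map (\<lambda>x. c * x) a"

definition sa_mult ::
    "('s::semigroup_mult \<Rightarrow>\<^sub>0 'k::comm_ring_1) \<Rightarrow> ('s \<Rightarrow>\<^sub>0 'k) \<Rightarrow> ('s \<Rightarrow>\<^sub>0 'k)"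
    (infixl \<open>\<star>\<close> 70) where
  "a \<star> b = (\<Sum>s\<in>Poly_Mapping.keys a. \<Sum>t\<in>Poly_Mapping.keys b.
     Poly_Mapping.single (s * t) (Poly_Mapping.lookup a s * Poly_Mapping.lookup b t))"

definition sa_center :: "('s::semigroup_mult \<Rightarrow>\<^sub>0 'k::comm_ring_1) set" where
  "sa_center = {z. \<forall>a. z \<star> a = a \<star> z}"


section \<open>Functions on topological groupoids\<close>

text \<open>\<open>gmul\<close> is only meaningful on composable arrows. Sources and ranges live in a type of their
  own, to which the unit space is identified.\<close>

record ('g, 'x) top_groupoid =
  arr_top :: "'g topology"
  src :: "'g \<Rightarrow> 'x"
  rng :: "'g \<Rightarrow> 'x"
  gmul :: "'g \<Rightarrow> 'g \<Rightarrow> 'g"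
  ginv :: "'g \<Rightarrow> 'g"

abbreviation arrows :: "('g, 'x) top_groupoid \<Rightarrow> 'g set" where
  "arrows G \<equiv> topspace (arr_top G)"

text \<open>A function on the groupoid is a function on the type of arrows that is zero outside
  \<open>arrows G\<close>; for the generators this follows since \<open>V \<subseteq> arrows G\<close>.\<close>

definition groupoid_generators :: "('g, 'x) top_groupoid \<Rightarrow> ('g \<Rightarrow> 'k::comm_ring_1) set" where
  "groupoid_generators G = {f. \<exists>V. openin (arr_top G) V
      \<and> Hausdorff_space (subtopology (arr_top G) V)
      \<and> (\<forall>x. x \<notin> V \<longrightarrow> f x = 0)
      \<and> continuous_map (subtopology (arr_top G) V) (discrete_topology UNIV) f
      \<and> compactin (subtopology (arr_top G) V)
          (subtopology (arr_top G) V closure_of {x \<in> V. f x \<noteq> 0})}"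

definition fun_scale :: "'k::comm_ring_1 \<Rightarrow> ('g \<Rightarrow> 'k) \<Rightarrow> ('g \<Rightarrow> 'k)" where
  "fun_scale c f = (\<lambda>x. c * f x)"

definition groupoid_algebra :: "('g, 'x) top_groupoid \<Rightarrow> ('g \<Rightarrow> 'k::comm_ring_1) set" where
  "groupoid_algebra G = module.span fun_scale (groupoid_generators G)"

text \<open>The fibre of \<open>src G\<close> may be infinite, where \<^const>\<open>sum\<close> would return zero; hence the
  restriction to the nonzero summands.\<close>

definition convolution ::
    "('g, 'x) top_groupoid \<Rightarrow> ('g \<Rightarrow> 'k::comm_ring_1) \<Rightarrow> ('g \<Rightarrow> 'k) \<Rightarrow> ('g \<Rightarrow> 'k)" where
  "convolution G f g = (\<lambda>x. if x \<in> arrows G then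
     (\<Sum>y | y \<in> arrows G \<and> src G y = src G x \<and> f (gmul G x (ginv G y)) * g y \<noteq> 0.
        f (gmul G x (ginv G y)) * g y) else 0)"

definition class_functions :: "('g, 'x) top_groupoid \<Rightarrow> ('g \<Rightarrow> 'k::comm_ring_1) set" where
  "class_functions G = {f \<in> groupoid_algebra G.
      (\<forall>x\<in>arrows G. f x \<noteq> 0 \<longrightarrow> src G x = rng G x)
    \<and> (\<forall>x\<in>arrows G. \<forall>z\<in>arrows G. src G x = rng G x \<and> rng G x = src G z
         \<longrightarrow> f (gmul G (gmul G z x) (ginv G z)) = f x)}"


section \<open>The universal groupoid of an inverse semigroup\<close>

text \<open>The semilattice \<open>{0,1}\<close> is \<^typ>\<open>bool\<close> with conjunction. Maps on \<open>E(S)\<close> are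
  represented by extensional functions, so that they form the product space.\<close>

definition chars :: "('s::inverse_semigroup \<Rightarrow> bool) set" where
  "chars = {\<phi> \<in> extensional idems.
      (\<forall>e\<in>idems. \<forall>f\<in>idems. \<phi> (e * f) \<longleftrightarrow> \<phi> e \<and> \<phi> f) \<and> (\<exists>e\<in>idems. \<phi> e)}"

definition chars_top :: "('s::inverse_semigroup \<Rightarrow> bool) topology" where
  "chars_top = subtopology (product_topology (\<lambda>_. discrete_topology UNIV) idems) chars"

definition chars_at :: "'s::inverse_semigroup \<Rightarrow> ('s \<Rightarrow> bool) set" where
  "chars_at e = {\<phi> \<in> chars. \<phi> e}"

definition act :: "'s::inverse_semigroup \<Rightarrow> ('s \<Rightarrow> bool) \<Rightarrow> ('s \<Rightarrow> bool)" where
  "act s \<phi> = (\<lambda>e\<in>idems. \<phi> (star s * e * s))"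

definition germ_rel ::
    "(('s::inverse_semigroup \<times> ('s \<Rightarrow> bool)) \<times> ('s \<times> ('s \<Rightarrow> bool))) set" where
  "germ_rel = {((s, \<phi>), (t, \<psi>)). \<phi> \<in> chars_at (star s * s) \<and> \<psi> \<in> chars_at (star t * t)
      \<and> \<phi> = \<psi> \<and> (\<exists>u. nat_le u s \<and> nat_le u t \<and> \<phi> \<in> chars_at (star u * u))}"

definition germ :: "'s::inverse_semigroup \<Rightarrow> ('s \<Rightarrow> bool) \<Rightarrow> ('s \<times> ('s \<Rightarrow> bool)) set" where
  "germ s \<phi> = germ_rel `` {(s, \<phi>)}"

definition slice ::
    "'s::inverse_semigroup \<Rightarrow> ('s \<Rightarrow> bool) set \<Rightarrow> ('s \<times> ('s \<Rightarrow> bool)) set set" where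
  "slice s U = {germ s \<phi> | \<phi>. \<phi> \<in> U}"

text \<open>Operations on classes are defined by uniting over (or, for \<open>src\<close> and \<open>rng\<close>, taking the only
  value at) all representatives; the lemmas below evaluate them on given representatives.\<close>

definition universal_groupoid ::
    "(('s::inverse_semigroup \<times> ('s \<Rightarrow> bool)) set, 's \<Rightarrow> bool) top_groupoid" where
  "universal_groupoid = \<lparr>
     arr_top = topology_generated_by
       {slice s U | s U. openin chars_top U \<and> U \<subseteq> chars_at (star s * s)},
     src = (\<lambda>X. the_elem (snd ` X)),
     rng = (\<lambda>X. the_elem ((\<lambda>(s, \<phi>). act s \<phi>) ` X)),
     gmul = (\<lambda>X Y. \<Union>(s, \<phi>)\<in>X. \<Union>(t, \<psi>)\<in>Y. germ (s * t) \<psi>),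
     ginv = (\<lambda>X. \<Union>(s, \<phi>)\<in>X. germ (star s) (act s \<phi>))\<rparr>"

lemma charsD:
  assumes "\<phi> \<in> chars" "e \<in> idems" "f \<in> idems"
  shows "\<phi> (e * f) \<longleftrightarrow> \<phi> e \<and> \<phi> f"
  using assms by (simp add: chars_def)

lemma act_apply: "e \<in> idems \<Longrightarrow> act s \<phi> e = \<phi> (star s * e * s)"
  by (simp add: act_def)

lemma act_mem:
  assumes "\<phi> \<in> chars_at (star s * s)"
  shows "act s \<phi> \<in> chars_at (s * star s)"
proof -
  have p: "\<phi> \<in> chars" "\<phi> (star s * s)" using assms by (auto simp: chars_at_def)
  have 1: "act s \<phi> (s * star s)"
    using p by (simp add: act_apply star_mult_idems star_props flip: mult.assoc)
  have "act s \<phi> (e * f) \<longleftrightarrow> act s \<phi> e \<and> act s \<phi> f" if ef: "e \<in> idems" "f \<in> idems" for e f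
  proof -
    have c: "(s * star s) * f = f * (s * star s)"
      by (rule idems_commute) (simp_all add: ef star_mult_idems)
    have "(star s * e * s) * (star s * f * s) = star s * e * ((s * star s) * f) * s"
      by (simp add: mult.assoc)
    also have "\<dots> = star s * (e * f) * (s * star s * s)"
      by (subst c) (simp add: mult.assoc)
    finally have "star s * (e * f) * s = (star s * e * s) * (star s * f * s)"
      by (simp add: star_props)
    then show ?thesis
      using ef p(1) by (simp add: act_apply idems_mult charsD conj_idems)
  qed
  then show ?thesis
    using 1 star_mult_idems(2)[of s] by (auto simp: chars_at_def chars_def act_def)
qed

lemma nat_le_char:
  assumes "nat_le u s" "\<phi> \<in> chars_at (star u * u)"
  shows "\<phi> \<in> chars_at (star s * s)" "act u \<phi> = act s \<phi>"
proof -
  obtain e where e: "e \<in> idems" "u = e * s" using assms(1) by (auto simp: nat_le_def)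
  have ee: "e * (e * z) = e * z" for z using e(1) by (simp add: idems_def flip: mult.assoc)
  have su: "star u = star s * e" using e by (simp add: star_mult star_idem)
  have uu: "star u * u = star s * e * s" by (simp only: su) (simp add: e(2) mult.assoc ee)
  have p: "\<phi> \<in> chars" "\<phi> (star s * e * s)" using assms(2) by (auto simp: chars_at_def uu)
  have "(star s * e * s) * (star s * s) = star s * e * s"
    using star_props(1)[of s] by (simp add: mult.assoc)
  then show "\<phi> \<in> chars_at (star s * s)"
    using charsD[OF p(1) conj_idems[OF e(1), of s] star_mult_idems(1)[of s]] p
    by (simp add: chars_at_def)
  have "\<phi> (star u * f * u) = \<phi> (star s * f * s)" if f: "f \<in> idems" for f
  proof -
    have c: "(s * star s) * f = f * (s * star s)" "f * e = e * f"
      by (rule idems_commute; simp add: f e star_mult_idems)+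
    have "(star s * e * s) * (star s * f * s) = star s * e * ((s * star s) * f) * s"
      by (simp add: mult.assoc)
    also have "\<dots> = star s * e * f * (s * star s * s)"
      by (subst c(1)) (simp add: mult.assoc)
    finally have 1: "(star s * e * s) * (star s * f * s) = star s * e * f * s"
      by (simp add: star_props)
    have "star u * f * u = star s * e * (f * e) * s"
      by (simp only: su) (simp add: e(2) mult.assoc)
    then have "star u * f * u = (star s * e * s) * (star s * f * s)"
      by (simp add: c(2) 1) (simp add: mult.assoc ee)
    then show ?thesis
      using p f e(1) by (simp add: charsD conj_idems)
  qed
  then show "act u \<phi> = act s \<phi>" by (auto simp: act_def restrict_def fun_eq_iff)
qed

lemma nat_le_refl: "nat_le s s"
  unfolding nat_le_def
  by (rule bexI[of _ "s * star s"]) (simp_all add: star_props star_mult_idems)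

lemma nat_le_meet:
  assumes "nat_le u s" "nat_le v s" "\<phi> \<in> chars_at (star u * u)" "\<phi> \<in> chars_at (star v * v)"
  shows "\<exists>w. nat_le w u \<and> nat_le w v \<and> \<phi> \<in> chars_at (star w * w)"
proof -
  obtain e f where e: "e \<in> idems" "u = e * s" and f: "f \<in> idems" "v = f * s"
    using assms(1,2) by (auto simp: nat_le_def)
  have su: "star u = star s * e" using e by (simp add: star_mult star_idem)
  have sv: "star v = star s * f" using f by (simp add: star_mult star_idem)
  have ee: "e * (e * z) = e * z" "f * (f * z) = f * z" for z
    using e(1) f(1) by (simp_all add: idems_def flip: mult.assoc)
  let ?w = "f * u"
  have w: "?w = e * v"
    using idems_commute[OF e(1) f(1)] by (simp add: e f flip: mult.assoc)
  have sw: "star ?w = star u * f"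
    using star_mult[of f u] f by (simp add: star_idem)
  have "star ?w * ?w = star u * f * u"
    by (simp only: sw mult.assoc ee)
  also have "\<phi> (star u * f * u) = act u \<phi> f"
    using f by (simp add: act_apply)
  also have "\<dots> = act v \<phi> f"
    using nat_le_char(2)[OF assms(1,3)] nat_le_char(2)[OF assms(2,4)] by simp
  also have "\<dots> = \<phi> (star v * v)"
    using f by (simp add: act_apply sv mult.assoc ee)
  also have "\<dots>" using assms(4) by (simp add: chars_at_def)
  finally have "\<phi> \<in> chars_at (star ?w * ?w)" using assms(3) by (simp add: chars_at_def)
  then show ?thesis using e(1) f(1) w by (metis nat_le_def)
qed

lemma nat_le_trans: "nat_le u s \<Longrightarrow> nat_le s t \<Longrightarrow> nat_le u t"
  unfolding nat_le_def by (auto intro: idems_mult simp flip: mult.assoc)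

lemma equiv_germ_rel:
  "equiv {(s, \<phi>). \<phi> \<in> chars_at (star s * s)} (germ_rel :: (('s::inverse_semigroup \<times> _) \<times> _) set)"
  (is "equiv ?A ?R")
proof (rule equivI)
  show "?R \<subseteq> ?A \<times> ?A"
    by (auto simp: germ_rel_def)
  show "refl_on ?A ?R"
    by (auto simp: refl_on_def germ_rel_def intro: nat_le_refl)
  show "sym ?R" by (auto simp: sym_def germ_rel_def)
  show "trans ?R"
  proof (rule transI)
    fix x y z :: "'s \<times> ('s \<Rightarrow> bool)"
    assume xy: "(x, y) \<in> ?R" and yz: "(y, z) \<in> ?R"
    have "snd y = snd x" "snd z = snd x" using xy yz by (auto simp: germ_rel_def)
    then obtain r s t \<phi> where e: "x = (r, \<phi>)" "y = (s, \<phi>)" "z = (t, \<phi>)"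
      by (metis prod.collapse)
    obtain u where u: "nat_le u r" "nat_le u s" "\<phi> \<in> chars_at (star u * u)"
      using xy unfolding e germ_rel_def by auto
    obtain v where v: "nat_le v s" "nat_le v t" "\<phi> \<in> chars_at (star v * v)"
      using yz unfolding e germ_rel_def by auto
    obtain w where "nat_le w u" "nat_le w v" "\<phi> \<in> chars_at (star w * w)"
      using nat_le_meet[OF u(2) v(1) u(3) v(3)] by auto
    then have "\<exists>w. nat_le w r \<and> nat_le w t \<and> \<phi> \<in> chars_at (star w * w)"
      using u v nat_le_trans by blast
    then show "(x, z) \<in> ?R" using xy yz unfolding e germ_rel_def by auto
  qed
qed

lemma germ_mem: "(t, \<psi>) \<in> germ s \<phi> \<longleftrightarrow> \<psi> = \<phi> \<and> ((s, \<phi>), (t, \<phi>)) \<in> germ_rel"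
  by (auto simp: germ_def germ_rel_def)

lemma germ_refl: "\<phi> \<in> chars_at (star s * s) \<Longrightarrow> (s, \<phi>) \<in> germ s \<phi>"
  by (auto simp: germ_mem germ_rel_def intro: nat_le_refl)

lemma germ_eq:
  assumes "nat_le u s" "nat_le u t" "\<phi> \<in> chars_at (star u * u)"
  shows "germ s \<phi> = germ t \<phi>"
  unfolding germ_def
  by (rule equiv_class_eq[OF equiv_germ_rel]) (use assms nat_le_char(1) in \<open>auto simp: germ_rel_def\<close>)

lemma germ_memE:
  assumes "(t, \<psi>) \<in> germ s \<phi>"
  obtains u where "\<psi> = \<phi>" "nat_le u s" "nat_le u t" "\<phi> \<in> chars_at (star u * u)"
  using assms by (auto simp: germ_mem germ_rel_def)

lemma nat_le_mult:
  assumes "nat_le u s" "nat_le v t"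
  shows "nat_le (u * v) (s * t)"
proof -
  obtain e f where e: "e \<in> idems" "u = e * s" and f: "f \<in> idems" "v = f * t"
    using assms by (auto simp: nat_le_def)
  have sf: "s * f * star s \<in> idems"
    using conj_idems[OF f(1), of "star s"] by (simp add: star_star)
  have c: "(star s * s) * f = f * (star s * s)"
    by (rule idems_commute) (simp_all add: f star_mult_idems)
  have "s * f * star s * s = s * (f * (star s * s))" by (simp add: mult.assoc)
  also have "\<dots> = (s * star s * s) * f" by (subst c[symmetric]) (simp add: mult.assoc)
  finally have "s * f = s * f * star s * s" by (simp add: star_props)
  then have "e * (s * f) * t = e * (s * f * star s * s) * t" by simp
  then have "u * v = (e * (s * f * star s)) * (s * t)"
    by (simp add: e f mult.assoc)
  then show ?thesis using idems_mult[OF e(1) sf] by (auto simp: nat_le_def)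
qed

lemma nat_le_star:
  assumes "nat_le u s"
  shows "nat_le (star u) (star s)"
proof -
  obtain e where e: "e \<in> idems" "u = e * s" using assms by (auto simp: nat_le_def)
  have c: "(s * star s) * e = e * (s * star s)"
    by (rule idems_commute) (simp_all add: e star_mult_idems)
  have "star s * e = star s * ((s * star s) * e)"
    using star_props(2)[of s] by (simp flip: mult.assoc)
  also have "\<dots> = (star s * e * s) * star s" by (subst c) (simp add: mult.assoc)
  finally have "star u = (star s * e * s) * star s" using e by (simp add: star_mult star_idem)
  then show ?thesis using conj_idems[OF e(1)] by (auto simp: nat_le_def)
qed

lemma chars_at_mult:
  assumes "\<psi> \<in> chars_at (star t * t)" "act t \<psi> \<in> chars_at (star s * s)"
  shows "\<psi> \<in> chars_at (star (s * t) * (s * t))"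
  using assms by (simp add: chars_at_def act_apply star_mult_idems star_mult mult.assoc)

lemma src_germ:
  assumes "\<phi> \<in> chars_at (star s * s)"
  shows "src universal_groupoid (germ s \<phi>) = \<phi>"
proof -
  have "snd ` germ s \<phi> = {\<phi>}" using germ_refl[OF assms] by (auto intro: rev_image_eqI elim: germ_memE)
  then show ?thesis by (simp add: universal_groupoid_def)
qed

lemma rng_germ:
  assumes "\<phi> \<in> chars_at (star s * s)"
  shows "rng universal_groupoid (germ s \<phi>) = act s \<phi>"
proof -
  have *: "act t \<psi> = act s \<phi>" if t: "(t, \<psi>) \<in> germ s \<phi>" for t \<psi>
  proof -
    obtain u where u: "\<psi> = \<phi>" "nat_le u s" "nat_le u t" "\<phi> \<in> chars_at (star u * u)"
      using t by (rule germ_memE)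
    show ?thesis
      using nat_le_char(2)[OF u(2,4)] nat_le_char(2)[OF u(3,4)] u(1) by simp
  qed
  have "(\<lambda>(t, \<psi>). act t \<psi>) ` germ s \<phi> = (\<lambda>_. act s \<phi>) ` germ s \<phi>"
    by (rule image_cong[OF refl]) (clarify, rule *)
  also have "\<dots> = {act s \<phi>}"
    using germ_refl[OF assms] by blast
  finally show ?thesis by (simp add: universal_groupoid_def)
qed

lemma gmul_germ:
  assumes "\<psi> \<in> chars_at (star t * t)" "act t \<psi> \<in> chars_at (star s * s)"
  shows "gmul universal_groupoid (germ s (act t \<psi>)) (germ t \<psi>) = germ (s * t) \<psi>"
proof -
  have *: "germ (s' * t') \<psi>' = germ (s * t) \<psi>"
    if s': "(s', \<phi>') \<in> germ s (act t \<psi>)" and t': "(t', \<psi>') \<in> germ t \<psi>" for s' t' \<phi>' \<psi>'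
  proof -
    obtain u where u: "nat_le u s" "nat_le u s'" "act t \<psi> \<in> chars_at (star u * u)"
      using s' by (rule germ_memE)
    obtain v where v: "\<psi>' = \<psi>" "nat_le v t" "nat_le v t'" "\<psi> \<in> chars_at (star v * v)"
      using t' by (rule germ_memE)
    have "\<psi> \<in> chars_at (star (u * v) * (u * v))"
      by (rule chars_at_mult[OF v(4)]) (use u(3) nat_le_char(2)[OF v(2,4)] in simp)
    then show ?thesis
      using germ_eq[OF nat_le_mult[OF u(2) v(3)] nat_le_mult[OF u(1) v(2)]] v(1) by simp
  qed
  have "(\<Union>(s', \<phi>')\<in>germ s (act t \<psi>). \<Union>(t', \<psi>')\<in>germ t \<psi>. germ (s' * t') \<psi>')
      = (\<Union>p\<in>germ s (act t \<psi>). \<Union>q\<in>germ t \<psi>. germ (s * t) \<psi>)"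
    by (intro SUP_cong refl) (clarify, intro SUP_cong refl, clarify, rule *)
  also have "\<dots> = germ (s * t) \<psi>"
    using germ_refl[OF assms(1)] germ_refl[OF assms(2)] by blast
  finally show ?thesis by (simp add: universal_groupoid_def)
qed

lemma ginv_germ:
  assumes "\<phi> \<in> chars_at (star s * s)"
  shows "ginv universal_groupoid (germ s \<phi>) = germ (star s) (act s \<phi>)"
proof -
  have *: "germ (star t) (act t \<psi>) = germ (star s) (act s \<phi>)" if t: "(t, \<psi>) \<in> germ s \<phi>" for t \<psi>
  proof -
    obtain u where u: "\<psi> = \<phi>" "nat_le u s" "nat_le u t" "\<phi> \<in> chars_at (star u * u)"
      using t by (rule germ_memE)
    have "act u \<phi> = act s \<phi>" "act u \<phi> = act t \<phi>" using u nat_le_char(2) by blast+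
    moreover have "act u \<phi> \<in> chars_at (star (star u) * star u)"
      using act_mem[OF u(4)] by (simp add: star_star)
    ultimately show ?thesis
      using germ_eq[OF nat_le_star[OF u(3)] nat_le_star[OF u(2)], of "act u \<phi>"] u(1) by simp
  qed
  have "(\<Union>(t, \<psi>)\<in>germ s \<phi>. germ (star t) (act t \<psi>)) = (\<Union>p\<in>germ s \<phi>. germ (star s) (act s \<phi>))"
    by (intro SUP_cong refl) (clarsimp simp: *)
  also have "\<dots> = germ (star s) (act s \<phi>)"
    using germ_refl[OF assms] by blast
  finally show ?thesis by (simp add: universal_groupoid_def)
qed

lemma arrows_universal_groupoid:
  "arrows universal_groupoid = {(s, \<phi>). \<phi> \<in> chars_at (star s * s)} // germ_rel"
proof -
  have "openin chars_top (chars_at (star s * s))" for s :: 'a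
  proof -
    have "openin (product_topology (\<lambda>_. discrete_topology UNIV) idems)
            {\<phi> \<in> topspace (product_topology (\<lambda>_. discrete_topology UNIV) (idems :: 'a set)).
               \<phi> (star s * s) \<in> {True}}"
      by (rule openin_continuous_map_preimage[OF continuous_map_product_projection])
        (simp_all add: star_mult_idems)
    moreover have "chars_at (star s * s) =
        {\<phi> \<in> topspace (product_topology (\<lambda>_. discrete_topology UNIV) idems).
               \<phi> (star s * s) \<in> {True}} \<inter> chars"
      by (auto simp: chars_at_def chars_def topspace_product_topology PiE_def)
    ultimately show ?thesis unfolding chars_top_def by (subst openin_subtopology) blast
  qed
  then have "slice s (chars_at (star s * s)) \<subseteq> arrows universal_groupoid" for s :: 'a
    unfolding universal_groupoid_def top_groupoid.simps topology_generated_by_topspace by blast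
  moreover have "x \<in> (\<Union>s. slice s (chars_at (star s * s)))" if "x \<in> arrows universal_groupoid" for x :: "('a \<times> _) set"
    using that
    unfolding universal_groupoid_def top_groupoid.simps topology_generated_by_topspace
    by (auto simp: slice_def)
  ultimately have "arrows universal_groupoid = (\<Union>s :: 'a. slice s (chars_at (star s * s)))"
    by blast
  also have "\<dots> = {(s, \<phi>). \<phi> \<in> chars_at (star s * s)} // germ_rel"
    by (auto simp: slice_def germ_def quotient_def)
  finally show ?thesis .
qed

text \<open>The linear extension of \<open>s \<mapsto> \<chi>\<close>, where \<open>\<chi>\<close> is the characteristic function of
  \<open>(s, D(s\<^sup>*s))\<close>.\<close>

definition sa_to_groupoid ::
    "('s::inverse_semigroup \<Rightarrow>\<^sub>0 'k::comm_ring_1) \<Rightarrow> ('s \<times> ('s \<Rightarrow> bool)) set \<Rightarrow> 'k" where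
  "sa_to_groupoid a = (\<lambda>x. \<Sum>s\<in>Poly_Mapping.keys a.
     Poly_Mapping.lookup a s * indicator (slice s (chars_at (star s * s))) x)"

definition sa_groupoid_iso ::
    "(('s::inverse_semigroup \<Rightarrow>\<^sub>0 'k::comm_ring_1) \<Rightarrow> ('s \<times> ('s \<Rightarrow> bool)) set \<Rightarrow> 'k) \<Rightarrow> bool" where
  "sa_groupoid_iso F \<longleftrightarrow> module_hom sa_scale fun_scale F
     \<and> (\<forall>a b. F (a \<star> b) = convolution universal_groupoid (F a) (F b))
     \<and> bij_betw F UNIV (groupoid_algebra universal_groupoid)"

end

theory Submission
  imports Defs
begin

text \<open>The map \<open>KS \<rightarrow> K\<G>(S)\<close> is injective because, for \<open>s\<close> maximal in the support of \<open>a\<close>, the germ of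
  \<open>s\<close> at the principal character of \<open>s\<^sup>*s\<close> lies in no other slice \<open>(t, D(t\<^sup>*t))\<close> with \<open>t\<close> in the
  support, so the image of \<open>a\<close> takes the value \<open>a(s)\<close> there. It is surjective because the subsets of
  the spectrum whose characteristic functions, composed with the source map, multiply the image into
  itself pointwise form a Boolean algebra containing every \<open>D(e)\<close>; by compactness the image then
  contains the characteristic functions of all compact open subsets of slices, and these span.

  Convolving \<open>f\<close> with \<open>\<chi>\<close> of \<open>(s, D(s\<^sup>*s))\<close> on the two sides translates \<open>f\<close> by germs of \<open>s\<close>. Taking
  \<open>s\<close> idempotent, commutation forces the support into the isotropy; for general \<open>s\<close> it is then
  invariance under conjugation. The unit is the characteristic function of the unit space, which
  is in the image once finitely many \<open>D(e)\<close> cover the spectrum; conversely, if \<open>u\<close> is a unit then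
  the compact sets \<open>D(t\<^sup>*t)\<close>, with \<open>t\<close> in the support of \<open>u\<close>, cover the spectrum.\<close>

section \<open>Germs\<close>

abbreviation germ_dom :: "'s::inverse_semigroup \<Rightarrow> ('s \<Rightarrow> bool) set" where
  "germ_dom s \<equiv> chars_at (star s * s)"

abbreviation full_slice :: "'s::inverse_semigroup \<Rightarrow> ('s \<times> ('s \<Rightarrow> bool)) set set" where
  "full_slice s \<equiv> slice s (germ_dom s)"

lemma act_act: "act s (act t \<phi>) = act (s * t) \<phi>"
  using conj_idems by (auto simp: act_def fun_eq_iff restrict_def star_mult mult.assoc)

text \<open>Since \<open>\<phi> e\<close> holds, the outer factors of \<open>e * f * e\<close> do
  not affect the value of \<open>\<phi>\<close>. Outside \<open>idems\<close> both sides take the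
  default value of extensional functions.\<close>

lemma act_idem:
  assumes "e \<in> idems" "\<phi> \<in> chars_at e"
  shows "act e \<phi> = \<phi>"
proof
  fix f
  show "act e \<phi> f = \<phi> f"
  proof (cases "f \<in> idems")
    case True
    have "\<phi> \<in> chars" "\<phi> e" using assms by (simp_all add: chars_at_def)
    then show ?thesis
      using True assms(1) by (simp add: act_apply charsD[of \<phi>] idems_mult star_idem)
  next
    case False
    then show ?thesis using assms by (simp add: act_def chars_at_def chars_def extensional_def)
  qed
qed

lemma act_star_act: "\<phi> \<in> germ_dom s \<Longrightarrow> act (star s) (act s \<phi>) = \<phi>"
  by (simp add: act_act act_idem star_mult_idems)

lemma act_mem_star: "\<phi> \<in> germ_dom s \<Longrightarrow> act s \<phi> \<in> germ_dom (star s)"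
  using act_mem[of \<phi> s] by (simp add: star_star)

text \<open>This is the domain rule for composing partial homeomorphisms. The domain idempotent of
  \<open>s * t\<close> lies below \<open>star t * t\<close>, and its value under
  \<open>\<phi>\<close> is the value of \<open>act t \<phi>\<close> at
  \<open>star s * s\<close>.\<close>

lemma germ_dom_mult_iff:
  assumes "\<phi> \<in> chars"
  shows "\<phi> \<in> germ_dom (s * t) \<longleftrightarrow> \<phi> \<in> germ_dom t \<and> act t \<phi> \<in> germ_dom s"
proof
  assume *: "\<phi> \<in> germ_dom (s * t)"
  have "star (s * t) * (s * t) * (star t * t) = star (s * t) * (s * t)"
    by (simp add: mult.assoc star_props(1)[of t, unfolded mult.assoc])
  then have t: "\<phi> \<in> germ_dom t"
    using * assms charsD[OF assms star_mult_idems(1) star_mult_idems(1), of "s * t" t]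
    by (simp add: chars_at_def)
  have "act t \<phi> (star s * s)"
    using * by (simp add: chars_at_def act_apply star_mult_idems star_mult mult.assoc)
  with t act_mem[OF t] show "\<phi> \<in> germ_dom t \<and> act t \<phi> \<in> germ_dom s"
    by (simp add: chars_at_def)
qed (auto intro: chars_at_mult)

lemma chars_at_idem_dom: "e \<in> idems \<Longrightarrow> star e * e = e"
  by (simp add: star_idem idems_def)

lemma germ_dom_mult_idem:
  assumes "e \<in> idems"
  shows "germ_dom (s * e) = germ_dom s \<inter> chars_at e"
proof -
  have "\<phi> \<in> germ_dom (s * e) \<longleftrightarrow> \<phi> \<in> germ_dom s \<inter> chars_at e" if "\<phi> \<in> chars" for \<phi>
    using germ_dom_mult_iff[OF that, of s e] act_idem[OF assms, of \<phi>]
    by (auto simp: chars_at_idem_dom assms)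
  then show ?thesis by (auto simp: chars_at_def)
qed

lemma germ_mult_cong_left:
  assumes "germ s (act t \<phi>) = germ s' (act t \<phi>)" "\<phi> \<in> germ_dom t"
    "act t \<phi> \<in> germ_dom s" "act t \<phi> \<in> germ_dom s'"
  shows "germ (s * t) \<phi> = germ (s' * t) \<phi>"
  using gmul_germ[OF assms(2,3)] gmul_germ[OF assms(2,4)] assms(1) by simp

text \<open>Commuting \<open>e\<close> past \<open>star s * s\<close> rewrites \<open>s * e\<close>
  as \<open>(s * e * star s) * s\<close>, so it lies below \<open>s\<close> in the natural
  order.\<close>

lemma germ_mult_idem:
  assumes "e \<in> idems" "\<phi> \<in> germ_dom (s * e)"
  shows "germ (s * e) \<phi> = germ s \<phi>"
proof -
  have "e * (star s * s) = (star s * s) * e"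
    by (rule idems_commute) (simp_all add: assms star_mult_idems)
  then have "s * e * star s * s = s * star s * s * e"
    by (simp add: mult.assoc)
  then have "s * e = (s * e * star s) * s" by (simp add: star_props)
  moreover have "s * e * star s \<in> idems"
    using conj_idems[OF assms(1), of "star s"] by (simp add: star_star)
  ultimately have "nat_le (s * e) s" by (auto simp: nat_le_def)
  then show ?thesis using germ_eq[OF nat_le_refl] assms(2) by metis
qed

lemma arrowsE:
  assumes "x \<in> arrows universal_groupoid"
  obtains s \<phi> where "x = germ s \<phi>" "\<phi> \<in> germ_dom s"
  using assms unfolding arrows_universal_groupoid by (auto simp: quotient_def germ_def)

lemma germ_in_arrows: "\<phi> \<in> germ_dom s \<Longrightarrow> germ s \<phi> \<in> arrows universal_groupoid"
  unfolding arrows_universal_groupoid by (auto simp: quotient_def germ_def)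

lemma germ_eqD:
  assumes "germ s \<phi> = germ t \<psi>" "\<phi> \<in> germ_dom s" "\<psi> \<in> germ_dom t"
  shows "\<phi> = \<psi>"
  using src_germ[OF assms(2)] src_germ[OF assms(3)] assms(1) by simp

lemma germ_in_slice_iff:
  assumes "\<phi> \<in> germ_dom s" "U \<subseteq> germ_dom t"
  shows "germ s \<phi> \<in> slice t U \<longleftrightarrow> \<phi> \<in> U \<and> germ s \<phi> = germ t \<phi>"
proof
  assume "germ s \<phi> \<in> slice t U"
  then obtain \<psi> where \<psi>: "germ s \<phi> = germ t \<psi>" "\<psi> \<in> U" by (auto simp: slice_def)
  with germ_eqD[OF \<psi>(1) assms(1)] assms(2) show "\<phi> \<in> U \<and> germ s \<phi> = germ t \<phi>" by auto
qed (auto simp: slice_def)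

text \<open>This is cancellation in the groupoid: the quotient of the germs of \<open>r\<close> and
  \<open>t\<close> is a germ of \<open>s\<close> exactly when the germ of \<open>r\<close> is a germ
  of \<open>s * t\<close>. One multiplies on the right by the germ of \<open>t\<close> or of
  \<open>star t\<close>; the idempotent \<open>star t * t\<close> or \<open>t * star t\<close> that
  is left over is absorbed by \<open>germ_mult_idem\<close>.\<close>

lemma germ_mult_full_slice_iff:
  assumes "\<phi> \<in> germ_dom r" "\<phi> \<in> germ_dom t"
  shows "germ (r * star t) (act t \<phi>) \<in> full_slice s \<longleftrightarrow> germ r \<phi> \<in> full_slice (s * t)"
proof -
  have c: "\<phi> \<in> chars" using assms by (simp add: chars_at_def)
  have ct: "act t \<phi> \<in> chars" using act_mem[OF assms(2)] by (simp add: chars_at_def)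
  have d: "act t \<phi> \<in> germ_dom (r * star t)"
    using germ_dom_mult_iff[OF ct] assms act_star_act act_mem_star by metis
  show ?thesis
  proof
    assume "germ (r * star t) (act t \<phi>) \<in> full_slice s"
    then have s: "act t \<phi> \<in> germ_dom s" "germ (r * star t) (act t \<phi>) = germ s (act t \<phi>)"
      using germ_in_slice_iff[OF d, of "germ_dom s" s] by auto
    have st: "\<phi> \<in> germ_dom (s * t)" using s(1) assms by (simp add: germ_dom_mult_iff[OF c])
    have "germ r \<phi> = germ (r * (star t * t)) \<phi>"
      using germ_mult_idem[of "star t * t" \<phi> r] assms
      by (simp add: star_mult_idems germ_dom_mult_idem)
    also have "\<dots> = germ (s * t) \<phi>"
      using germ_mult_cong_left[OF s(2) assms(2) d s(1)] by (simp add: mult.assoc)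
    finally show "germ r \<phi> \<in> full_slice (s * t)" using st by (auto simp: slice_def)
  next
    assume "germ r \<phi> \<in> full_slice (s * t)"
    then have st: "\<phi> \<in> germ_dom (s * t)" "germ r \<phi> = germ (s * t) \<phi>"
      using germ_in_slice_iff[OF assms(1), of "germ_dom (s * t)" "s * t"] by auto
    have s: "act t \<phi> \<in> germ_dom s" using st(1) by (simp add: germ_dom_mult_iff[OF c])
    have "germ (r * star t) (act t \<phi>) = germ (s * t * star t) (act t \<phi>)"
      by (rule germ_mult_cong_left) (simp_all add: act_star_act st assms act_mem_star)
    also have "\<dots> = germ s (act t \<phi>)"
      using germ_mult_idem[of "t * star t" "act t \<phi>" s] s act_mem[OF assms(2)]
      by (simp add: star_mult_idems germ_dom_mult_idem mult.assoc)
    finally show "germ (r * star t) (act t \<phi>) \<in> full_slice s" using s by (auto simp: slice_def)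
  qed
qed

section \<open>Linearity and multiplicativity\<close>

lemma lookup_sa_scale: "Poly_Mapping.lookup (sa_scale c a) s = c * Poly_Mapping.lookup a s"
  by (simp add: sa_scale_def Poly_Mapping.map.rep_eq when_def)

lemma module_sa_scale: "module (sa_scale :: 'k::comm_ring_1 \<Rightarrow> ('s \<Rightarrow>\<^sub>0 'k) \<Rightarrow> _)"
  by unfold_locales (auto intro!: poly_mapping_eqI simp: lookup_sa_scale lookup_add algebra_simps)

lemma module_fun_scale: "module (fun_scale :: 'k::comm_ring_1 \<Rightarrow> ('g \<Rightarrow> 'k) \<Rightarrow> _)"
  by unfold_locales (auto simp: fun_scale_def fun_eq_iff algebra_simps)

text \<open>Cancellation can shrink supports, so sums over keys are compared over a common finite
  set containing them.\<close>

lemma sa_to_groupoid_superset: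
  assumes "finite A" "Poly_Mapping.keys a \<subseteq> A"
  shows "sa_to_groupoid a x = (\<Sum>s\<in>A. Poly_Mapping.lookup a s * indicator (full_slice s) x)"
  unfolding sa_to_groupoid_def
  by (rule sum.mono_neutral_left) (use assms in \<open>auto simp: in_keys_iff\<close>)

lemma sa_to_groupoid_single:
  "sa_to_groupoid (Poly_Mapping.single s c) x = c * indicator (full_slice s) x"
  by (subst sa_to_groupoid_superset[of "{s}"]) auto

lemma sa_to_groupoid_add: "sa_to_groupoid (a + b) = sa_to_groupoid a + sa_to_groupoid b"
proof
  fix x
  let ?A = "Poly_Mapping.keys a \<union> Poly_Mapping.keys b"
  have "sa_to_groupoid (a + b) x = (\<Sum>s\<in>?A. Poly_Mapping.lookup (a + b) s * indicator (full_slice s) x)"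
    by (rule sa_to_groupoid_superset) (auto simp: in_keys_iff lookup_add)
  also have "\<dots> = sa_to_groupoid a x + sa_to_groupoid b x"
    by (subst (1 2) sa_to_groupoid_superset[of ?A]) (auto simp: lookup_add algebra_simps sum.distrib)
  finally show "sa_to_groupoid (a + b) x = (sa_to_groupoid a + sa_to_groupoid b) x" by simp
qed

lemma sa_to_groupoid_scale: "sa_to_groupoid (sa_scale c a) = fun_scale c (sa_to_groupoid a)"
proof
  fix x
  have "sa_to_groupoid (sa_scale c a) x
      = (\<Sum>s\<in>Poly_Mapping.keys a. Poly_Mapping.lookup (sa_scale c a) s * indicator (full_slice s) x)"
    by (rule sa_to_groupoid_superset) (auto simp: in_keys_iff lookup_sa_scale)
  then show "sa_to_groupoid (sa_scale c a) x = fun_scale c (sa_to_groupoid a) x"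
    by (simp add: sa_to_groupoid_def fun_scale_def lookup_sa_scale sum_distrib_left mult.assoc)
qed

lemma module_hom_sa_to_groupoid: "module_hom sa_scale fun_scale sa_to_groupoid"
  by (intro module_hom.intro module_hom_axioms.intro module_sa_scale module_fun_scale
      sa_to_groupoid_add sa_to_groupoid_scale)

lemma sa_to_groupoid_zero: "sa_to_groupoid 0 = 0"
  by (rule module_hom.zero[OF module_hom_sa_to_groupoid])

lemma sa_to_groupoid_sum: "sa_to_groupoid (\<Sum>i\<in>I. f i) = (\<Sum>i\<in>I. sa_to_groupoid (f i))"
  by (rule module_hom.sum[OF module_hom_sa_to_groupoid])

lemma sum_fun_apply: "(\<Sum>i\<in>I. f i) x = (\<Sum>i\<in>I. f i x)"
  for f :: "'i \<Rightarrow> 'a \<Rightarrow> 'b::comm_monoid_add"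
  by (induction I rule: infinite_finite_induct) auto

section \<open>Convolution of images and multiplicativity\<close>

lemma sa_to_groupoid_mult_apply:
  "sa_to_groupoid (a \<star> b) x = (\<Sum>s\<in>Poly_Mapping.keys a. \<Sum>t\<in>Poly_Mapping.keys b.
     Poly_Mapping.lookup a s * Poly_Mapping.lookup b t * indicator (full_slice (s * t)) x)"
  unfolding sa_mult_def sa_to_groupoid_sum by (simp add: sum_fun_apply sa_to_groupoid_single)

lemma sa_to_groupoid_outside: "x \<notin> arrows universal_groupoid \<Longrightarrow> sa_to_groupoid a x = 0"
  unfolding sa_to_groupoid_def
  by (rule sum.neutral) (auto simp: slice_def indicator_def germ_in_arrows)

lemma gmul_ginv_germ:
  assumes "\<phi> \<in> germ_dom r" "\<phi> \<in> germ_dom t"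
  shows "gmul universal_groupoid (germ r \<phi>) (ginv universal_groupoid (germ t \<phi>))
    = germ (r * star t) (act t \<phi>)"
  using gmul_germ[of "act t \<phi>" "star t" r] assms
  by (simp add: ginv_germ act_mem_star act_star_act)

text \<open>The possibly infinite fibre over \<open>\<phi>\<close> reduces to a finite sum: an arrow
  with source \<open>\<phi>\<close> at which the image of \<open>b\<close> is nonzero is the germ of
  some key of \<open>b\<close>. The left factor \<open>f\<close> stays arbitrary, as it is later
  also the indicator of the unit space.\<close>

lemma convolution_sa_to_groupoid_germ:
  assumes "\<phi> \<in> germ_dom r"
  shows "convolution universal_groupoid f (sa_to_groupoid b) (germ r \<phi>)
    = (\<Sum>t | t \<in> Poly_Mapping.keys b \<and> \<phi> \<in> germ_dom t.
        f (germ (r * star t) (act t \<phi>)) * Poly_Mapping.lookup b t)"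
proof -
  let ?G = "universal_groupoid :: (('a \<times> ('a \<Rightarrow> bool)) set, 'a \<Rightarrow> bool) top_groupoid"
  let ?T = "{t \<in> Poly_Mapping.keys b. \<phi> \<in> germ_dom t}"
  let ?Y = "(\<lambda>t. germ t \<phi>) ` ?T"
  let ?h = "\<lambda>y. f (gmul ?G (germ r \<phi>) (ginv ?G y))"
  have Y: "y \<in> ?Y" if y: "y \<in> arrows ?G" "src ?G y = \<phi>" "sa_to_groupoid b y \<noteq> 0" for y
  proof -
    obtain t \<psi> where t: "y = germ t \<psi>" "\<psi> \<in> germ_dom t" using y(1) by (rule arrowsE)
    have "\<psi> = \<phi>" using y(2) src_germ[OF t(2)] t(1) by simp
    obtain s where "s \<in> Poly_Mapping.keys b" "y \<in> full_slice s"
    proof (rule ccontr)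
      assume "\<not> thesis"
      then have "\<forall>s\<in>Poly_Mapping.keys b. y \<notin> full_slice s" using that by blast
      then have "sa_to_groupoid b y = 0"
        unfolding sa_to_groupoid_def by (intro sum.neutral) simp
      with y(3) show False ..
    qed
    then show ?thesis
      using germ_in_slice_iff[OF t(2), of "germ_dom s" s] t \<open>\<psi> = \<phi>\<close> by auto
  qed
  have T: "y \<in> arrows ?G \<and> src ?G y = \<phi>" if "y \<in> ?Y" for y
    using that by (auto simp: src_germ germ_in_arrows)
  have "convolution ?G f (sa_to_groupoid b) (germ r \<phi>)
      = (\<Sum>y | y \<in> arrows ?G \<and> src ?G y = \<phi> \<and> ?h y * sa_to_groupoid b y \<noteq> 0. ?h y * sa_to_groupoid b y)"
    using assms by (simp add: convolution_def germ_in_arrows src_germ)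
  also have "\<dots> = (\<Sum>y\<in>?Y. ?h y * sa_to_groupoid b y)"
  proof (rule sum.mono_neutral_left)
    show "finite ?Y" by simp
    show "{y. y \<in> arrows ?G \<and> src ?G y = \<phi> \<and> ?h y * sa_to_groupoid b y \<noteq> 0} \<subseteq> ?Y"
    proof
      fix y
      assume "y \<in> {y. y \<in> arrows ?G \<and> src ?G y = \<phi> \<and> ?h y * sa_to_groupoid b y \<noteq> 0}"
      then show "y \<in> ?Y" by (intro Y) auto
    qed
    show "\<forall>y\<in>?Y - {y. y \<in> arrows ?G \<and> src ?G y = \<phi> \<and> ?h y * sa_to_groupoid b y \<noteq> 0}.
        ?h y * sa_to_groupoid b y = 0"
      using T by blast
  qed
  \<comment> \<open>Distinct keys can have the same germ at \<open>\<phi>\<close>, so the sum over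
    germs cannot simply be reindexed by keys. Each value is expanded over the keys and the order of
    summation is exchanged.\<close>
  also have "\<dots> = (\<Sum>y\<in>?Y. \<Sum>t\<in>?T. ?h y * (Poly_Mapping.lookup b t * indicator (full_slice t) y))"
  proof (rule sum.cong[OF refl])
    fix y assume "y \<in> ?Y"
    then obtain r' where r': "y = germ r' \<phi>" "\<phi> \<in> germ_dom r'" by auto
    have "sa_to_groupoid b y = (\<Sum>t\<in>?T. Poly_Mapping.lookup b t * indicator (full_slice t) y)"
      unfolding sa_to_groupoid_def
      by (rule sum.mono_neutral_right) (auto simp: r' germ_in_slice_iff indicator_def)
    then show "?h y * sa_to_groupoid b y
        = (\<Sum>t\<in>?T. ?h y * (Poly_Mapping.lookup b t * indicator (full_slice t) y))"
      by (simp add: sum_distrib_left)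
  qed
  also have "\<dots> = (\<Sum>t\<in>?T. \<Sum>y\<in>?Y. ?h y * (Poly_Mapping.lookup b t * indicator (full_slice t) y))"
    by (rule sum.swap)
  also have "\<dots> = (\<Sum>t\<in>?T. f (germ (r * star t) (act t \<phi>)) * Poly_Mapping.lookup b t)"
  proof (rule sum.cong[OF refl])
    fix t assume t: "t \<in> ?T"
    have "(\<Sum>y\<in>?Y. ?h y * (Poly_Mapping.lookup b t * indicator (full_slice t) y))
        = (\<Sum>y\<in>{germ t \<phi>}. ?h y * (Poly_Mapping.lookup b t * indicator (full_slice t) y))"
      by (rule sum.mono_neutral_right) (use t in \<open>auto simp: germ_in_slice_iff indicator_def\<close>)
    also have "\<dots> = f (germ (r * star t) (act t \<phi>)) * Poly_Mapping.lookup b t"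
      using t assms by (auto simp: gmul_ginv_germ indicator_def germ_in_slice_iff)
    finally show "(\<Sum>y\<in>?Y. ?h y * (Poly_Mapping.lookup b t * indicator (full_slice t) y))
        = f (germ (r * star t) (act t \<phi>)) * Poly_Mapping.lookup b t" .
  qed
  finally show ?thesis .
qed

lemma sa_to_groupoid_mult:
  "sa_to_groupoid (a \<star> b) = convolution universal_groupoid (sa_to_groupoid a) (sa_to_groupoid b)"
proof
  fix x :: "('a \<times> ('a \<Rightarrow> bool)) set"
  show "sa_to_groupoid (a \<star> b) x = convolution universal_groupoid (sa_to_groupoid a) (sa_to_groupoid b) x"
  proof (cases "x \<in> arrows universal_groupoid")
    case True
    then obtain r \<phi> where x: "x = germ r \<phi>" and r: "\<phi> \<in> germ_dom r" by (rule arrowsE)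
    have c: "\<phi> \<in> chars" using r by (simp add: chars_at_def)
    let ?T = "{t \<in> Poly_Mapping.keys b. \<phi> \<in> germ_dom t}"
    have "sa_to_groupoid (a \<star> b) x = (\<Sum>t\<in>Poly_Mapping.keys b. \<Sum>s\<in>Poly_Mapping.keys a.
        Poly_Mapping.lookup a s * Poly_Mapping.lookup b t * indicator (full_slice (s * t)) x)"
      unfolding sa_to_groupoid_mult_apply by (rule sum.swap)
    \<comment> \<open>A key \<open>t\<close> whose domain misses \<open>\<phi>\<close> contributes
      nothing, since the domain of \<open>s * t\<close> is contained in that of
      \<open>t\<close>.\<close>
    also have "\<dots> = (\<Sum>t\<in>?T. \<Sum>s\<in>Poly_Mapping.keys a.
        Poly_Mapping.lookup a s * Poly_Mapping.lookup b t * indicator (full_slice (s * t)) x)"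
      by (rule sum.mono_neutral_right)
        (auto simp: x germ_in_slice_iff[OF r] germ_dom_mult_iff[OF c] indicator_def intro!: sum.neutral)
    also have "\<dots> = (\<Sum>t\<in>?T. sa_to_groupoid a (germ (r * star t) (act t \<phi>)) * Poly_Mapping.lookup b t)"
      by (rule sum.cong[OF refl], unfold sa_to_groupoid_def sum_distrib_right, rule sum.cong[OF refl])
        (simp add: x indicator_def germ_mult_full_slice_iff[OF r])
    finally show ?thesis
      by (simp only: x convolution_sa_to_groupoid_germ[OF r])
  qed (simp add: sa_to_groupoid_outside convolution_def)
qed

section \<open>Injectivity\<close>

text \<open>This is the character of the principal filter generated by \<open>e\<close> in the
  semilattice \<open>idems\<close>: the equation \<open>e * f = e\<close> says that \<open>e\<close>
  lies below \<open>f\<close>.\<close>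

definition principal_char :: "'s::inverse_semigroup \<Rightarrow> ('s \<Rightarrow> bool)" where
  "principal_char e = (\<lambda>f\<in>idems. e * f = e)"

lemma principal_char_mem:
  assumes "e \<in> idems"
  shows "principal_char e \<in> chars_at e"
proof -
  have "e * (f * g) = e \<longleftrightarrow> e * f = e \<and> e * g = e" if "f \<in> idems" "g \<in> idems" for f g
  proof
    assume *: "e * (f * g) = e"
    have "e * f = e * (g * f) * f" by (simp add: * idems_commute[OF that(2,1)])
    also have "\<dots> = e * (g * (f * f))" by (simp only: mult.assoc)
    also have "\<dots> = e" using * that by (simp add: idems_def idems_commute[OF that(2,1)])
    finally have "e * f = e" .
    moreover have "e * g = e * (f * g) * g" by (simp add: *)
    then have "e * g = e * (f * (g * g))" by (simp only: mult.assoc)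
    then have "e * g = e" using * that by (simp add: idems_def)
    ultimately show "e * f = e \<and> e * g = e" ..
  qed (simp flip: mult.assoc)
  then show ?thesis
    using assms
    by (auto simp: chars_at_def chars_def principal_char_def idems_mult intro!: bexI[of _ e])
      (simp_all add: idems_def)
qed

lemma nat_le_antisym: "nat_le s t \<Longrightarrow> nat_le t s \<Longrightarrow> s = t"
proof -
  assume "nat_le s t" "nat_le t s"
  then obtain e f where e: "e \<in> idems" "s = e * t" and f: "f \<in> idems" "t = f * s"
    by (auto simp: nat_le_def)
  have "e * s = (e * e) * t" by (simp only: e(2) mult.assoc)
  then have "e * s = s" using e by (simp add: idems_def)
  then have "t = (f * e) * s" using f(2) by (simp add: mult.assoc)
  also have "\<dots> = e * (f * s)" by (simp add: idems_commute[OF f(1) e(1)] mult.assoc)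
  finally show "s = t" by (simp only: f(2)[symmetric] e(2)[symmetric])
qed

text \<open>Any \<open>u \<le> s\<close> whose domain contains the principal character of \<open>s\<^sup>*s\<close> equals \<open>s\<close>.\<close>

lemma principal_germ_in_full_slice:
  assumes "germ s (principal_char (star s * s)) \<in> full_slice t"
  shows "nat_le s t"
proof -
  let ?\<phi> = "principal_char (star s * s)"
  have d: "?\<phi> \<in> germ_dom s" by (rule principal_char_mem) (rule star_mult_idems)
  then have "germ s ?\<phi> = germ t ?\<phi>" "?\<phi> \<in> germ_dom t"
    using assms by (simp_all add: germ_in_slice_iff[OF d])
  then have "(s, ?\<phi>) \<in> germ t ?\<phi>" using germ_refl[OF d] by simp
  then obtain u where u: "nat_le u s" "nat_le u t" "?\<phi> \<in> germ_dom u" by (auto elim: germ_memE)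
  have *: "star s * s * (star u * u) = star s * s"
    using u(3) by (simp add: chars_at_def principal_char_def star_mult_idems)
  obtain e where e: "e \<in> idems" "u = e * s" using u(1) by (auto simp: nat_le_def)
  have "s = s * (star s * s) " by (simp add: star_props flip: mult.assoc)
  also have "\<dots> = s * (star s * s * (star u * u))" by (simp add: *)
  also have "\<dots> = s * (star u * u)" by (simp add: star_props flip: mult.assoc)
  also have "\<dots> = (s * star s * e) * (e * s)" by (simp add: e star_mult star_idem mult.assoc)
  also have "\<dots> = (e * (s * star s)) * (e * s)"
    using idems_commute[OF e(1) star_mult_idems(2), of s] by simp
  also have "\<dots> = e * ((s * star s) * e) * s" by (simp add: mult.assoc)
  also have "\<dots> = e * (e * (s * star s)) * s"
    using idems_commute[OF e(1) star_mult_idems(2), of s] by simp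
  also have "\<dots> = u"
    using e by (simp add: mult.assoc star_props(1)[of s, unfolded mult.assoc]) (simp add: idems_def flip: mult.assoc)
  finally show ?thesis using u(2) by simp
qed

lemma inj_sa_to_groupoid: "inj sa_to_groupoid"
proof -
  have "a = 0" if a: "sa_to_groupoid a = 0" for a :: "'s::inverse_semigroup \<Rightarrow>\<^sub>0 'k::comm_ring_1"
  proof (rule ccontr)
    assume "a \<noteq> 0"
    then have ne: "Poly_Mapping.keys a \<noteq> {}" by simp
    obtain s where s: "s \<in> Poly_Mapping.keys a"
      and max: "\<And>t. t \<in> Poly_Mapping.keys a \<Longrightarrow> nat_le s t \<Longrightarrow> t = s"
    proof -
      have "\<exists>m\<in>Poly_Mapping.keys a. \<forall>x\<in>Poly_Mapping.keys a. x \<noteq> m \<longrightarrow> \<not> (nat_le m x \<and> m \<noteq> x)"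
      proof (rule Finite_Set.bex_max_element)
        show "asymp_on (Poly_Mapping.keys a) (\<lambda>m x. nat_le m x \<and> m \<noteq> x)"
          using nat_le_antisym unfolding asymp_on_def by blast
        show "transp_on (Poly_Mapping.keys a) (\<lambda>m x. nat_le m x \<and> m \<noteq> x)"
          using nat_le_antisym nat_le_trans unfolding transp_on_def by blast
      qed (use ne in simp_all)
      then show ?thesis using that by blast
    qed
    let ?x = "germ s (principal_char (star s * s))"
    have d: "principal_char (star s * s) \<in> germ_dom s"
      by (rule principal_char_mem) (rule star_mult_idems)
    \<comment> \<open>A key whose slice contains this germ lies above \<open>s\<close>, so by
      maximality it is \<open>s\<close> itself.\<close>
    have "sa_to_groupoid a ?x = (\<Sum>t\<in>{s}. Poly_Mapping.lookup a t * indicator (full_slice t) ?x)"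
      unfolding sa_to_groupoid_def
      by (rule sum.mono_neutral_right)
        (use s max in \<open>auto simp: indicator_def dest: principal_germ_in_full_slice\<close>)
    also have "\<dots> = Poly_Mapping.lookup a s"
      by (simp add: germ_in_slice_iff[OF d] d)
    finally show False using a s by (simp add: in_keys_iff)
  qed
  then show ?thesis
    using module_hom.inj_iff_eq_0[OF module_hom_sa_to_groupoid] by blast
qed

section \<open>The topology of the spectrum\<close>

abbreviation cube_top :: "('s::inverse_semigroup \<Rightarrow> bool) topology" where
  "cube_top \<equiv> product_topology (\<lambda>_. discrete_topology UNIV) idems"

lemma topspace_cube: "topspace cube_top = extensional idems"
  by (auto simp: PiE_def)

lemma chars_top_eq: "chars_top = subtopology cube_top chars"
  by (simp add: chars_top_def)

lemma topspace_chars_top: "topspace chars_top = chars"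
  by (auto simp: chars_top_def chars_def PiE_def)

lemma clopen_cube:
  assumes "e \<in> idems"
  shows "openin cube_top {\<phi> \<in> extensional idems. \<phi> e}" "closedin cube_top {\<phi> \<in> extensional idems. \<phi> e}"
proof -
  have c: "continuous_map cube_top (discrete_topology UNIV) (\<lambda>\<phi>. \<phi> e)"
    by (rule continuous_map_product_projection[OF assms])
  have *: "{\<phi> \<in> extensional idems. \<phi> e} = {\<phi> \<in> topspace cube_top. \<phi> e \<in> {True}}"
    by (auto simp: PiE_def)
  show "openin cube_top {\<phi> \<in> extensional idems. \<phi> e}"
    unfolding * by (rule openin_continuous_map_preimage[OF c]) simp
  show "closedin cube_top {\<phi> \<in> extensional idems. \<phi> e}"
    unfolding * by (rule closedin_continuous_map_preimage[OF c]) simp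
qed

lemma clopen_chars_at:
  assumes "e \<in> idems"
  shows "openin chars_top (chars_at e)" "closedin chars_top (chars_at e)"
proof -
  have *: "chars_at e = {\<phi> \<in> extensional idems. \<phi> e} \<inter> chars"
    by (auto simp: chars_at_def chars_def)
  show "openin chars_top (chars_at e)"
    unfolding * chars_top_eq openin_subtopology using clopen_cube[OF assms] by blast
  show "closedin chars_top (chars_at e)"
    unfolding * chars_top_eq closedin_subtopology using clopen_cube[OF assms] by blast
qed

text \<open>The homomorphism condition at each pair of idempotents is closed in the compact cube.
  Being non-zero is in general not a closed condition, but membership in \<open>?C e\<close>
  guarantees it; hence \<open>chars_at e\<close> is closed in the cube even when
  \<open>chars\<close> is not.\<close>

lemma compactin_chars_at:
  assumes "e \<in> idems"
  shows "compactin chars_top (chars_at e)"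
proof -
  let ?C = "\<lambda>e. {\<phi> \<in> extensional idems. \<phi> e} :: ('a \<Rightarrow> bool) set"
  \<comment> \<open>The homomorphism condition at \<open>(f, g)\<close>, written as the union of two
    closed sets: both sides of the equivalence hold, or both fail.\<close>
  let ?M = "\<lambda>(f, g). (?C (f * g) \<inter> (?C f \<inter> ?C g)) \<union> ((topspace cube_top - ?C (f * g)) \<inter> (topspace cube_top - ?C f \<inter> ?C g))"
  have "closedin cube_top (?M p)" if p: "p \<in> idems \<times> idems" for p
  proof -
    obtain f g where fg: "p = (f, g)" "f \<in> idems" "g \<in> idems" using p by auto
    note c = clopen_cube[OF fg(2)] clopen_cube[OF fg(3)] clopen_cube[OF idems_mult[OF fg(2,3)]]
    show ?thesis
      unfolding fg(1) prod.case
      by (intro closedin_Un closedin_Int closedin_diff closedin_topspace openin_Int c)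
  qed
  then have "closedin cube_top (\<Inter>p\<in>idems \<times> idems. ?M p)"
    using assms by (intro closedin_INT) auto
  then have "closedin cube_top (?C e \<inter> (\<Inter>p\<in>idems \<times> idems. ?M p))"
    using clopen_cube[OF assms] by blast
  moreover have "?C e \<inter> (\<Inter>p\<in>idems \<times> idems. ?M p) = chars_at e"
    unfolding topspace_cube chars_at_def chars_def using assms by auto
  moreover have "compact_space (cube_top :: ('a \<Rightarrow> bool) topology)"
    by (simp add: compact_space_product_topology compact_space_discrete_topology)
  ultimately have "compactin cube_top (chars_at e)"
    by (simp add: closedin_compact_space)
  then show ?thesis
    unfolding chars_top_eq compactin_subtopology by (auto simp: chars_at_def)
qed

lemma Hausdorff_chars_top: "Hausdorff_space chars_top"
  unfolding chars_top_eq
  by (intro Hausdorff_space_subtopology)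
    (simp add: Hausdorff_space_product_topology)

text \<open>A basic box of the product topology constrains only finitely many coordinates, and
  prescribing the values of \<open>\<phi>\<close> there keeps a character inside the box.\<close>

lemma chars_top_basis:
  assumes "openin chars_top U" "\<phi> \<in> U"
  obtains Q where "finite Q" "Q \<subseteq> idems" "{\<psi> \<in> chars. \<forall>e\<in>Q. \<psi> e = \<phi> e} \<subseteq> U"
proof -
  obtain T where T: "openin cube_top T" "U = T \<inter> chars"
    using assms(1) unfolding chars_top_eq openin_subtopology by auto
  then obtain X where X: "finite {i \<in> idems. X i \<noteq> UNIV}" "\<phi> \<in> Pi\<^sub>E idems X" "Pi\<^sub>E idems X \<subseteq> T"
    using assms(2) unfolding openin_product_topology_alt by auto
  have "{\<psi> \<in> chars. \<forall>e\<in>{i \<in> idems. X i \<noteq> UNIV}. \<psi> e = \<phi> e} \<subseteq> U"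
  proof
    fix \<psi> assume \<psi>: "\<psi> \<in> {\<psi> \<in> chars. \<forall>e\<in>{i \<in> idems. X i \<noteq> UNIV}. \<psi> e = \<phi> e}"
    have "\<psi> i \<in> X i" if "i \<in> idems" for i
      using \<psi> X(2) that by (cases "X i = UNIV") (auto simp: PiE_iff)
    then have "\<psi> \<in> Pi\<^sub>E idems X" using \<psi> by (auto simp: PiE_iff chars_def)
    then show "\<psi> \<in> U" using \<psi> X(3) T(2) by auto
  qed
  then show ?thesis using that[OF X(1)] by blast
qed

section \<open>The topology of the universal groupoid\<close>

lemma germ_eqE:
  assumes "germ s \<phi> = germ t \<phi>" "\<phi> \<in> germ_dom t"
  obtains u where "nat_le u s" "nat_le u t" "\<phi> \<in> germ_dom u"
  using germ_refl[OF assms(2)] unfolding assms(1)[symmetric] by (elim germ_memE)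

text \<open>Openness can be tested in the spectrum, one \<open>s\<close> at a time. Traces commute
  with finite intersections and with unions, so induction on the generation of the topology reduces
  one direction to slices; conversely, \<open>W\<close> is the union of the slices over its
  traces.\<close>

lemma openin_arr_top_iff:
  "openin (arr_top universal_groupoid) W \<longleftrightarrow> W \<subseteq> arrows universal_groupoid
     \<and> (\<forall>s. openin chars_top {\<phi> \<in> germ_dom s. germ s \<phi> \<in> W})"
  (is "_ \<longleftrightarrow> _ \<and> (\<forall>s. openin chars_top (?P s W))")
proof
  assume W: "openin (arr_top universal_groupoid) W"
  let ?B = "{slice s U | s U. openin chars_top U \<and> U \<subseteq> germ_dom s}"
  have "generate_topology_on ?B W"
    using W by (simp add: universal_groupoid_def openin_topology_generated_by_iff)
  then have "openin chars_top (?P s W)" for s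
  proof induction
    case Empty
    then show ?case by simp
  next
    case (Int A B)
    have "?P s (A \<inter> B) = ?P s A \<inter> ?P s B" by auto
    with Int show ?case by auto
  next
    case (UN K)
    have "?P s (\<Union>K) = (\<Union>k\<in>K. ?P s k)" by auto
    with UN show ?case by auto
  next
    case (Basis A)
    then obtain t U where A: "A = slice t U" "openin chars_top U" "U \<subseteq> germ_dom t" by blast
    \<comment> \<open>Germs of \<open>s\<close> and \<open>t\<close> at \<open>\<phi>\<close> agree
      exactly when some common lower bound has \<open>\<phi>\<close> in its domain, so the trace of
      a slice is a union of open sets.\<close>
    have "?P s A = (\<Union>u\<in>{u. nat_le u s \<and> nat_le u t}. U \<inter> germ_dom u)"
    proof (intro equalityI subsetI)
      fix \<phi> assume "\<phi> \<in> ?P s A"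
      then have "\<phi> \<in> U" "germ s \<phi> = germ t \<phi>"
        using germ_in_slice_iff[OF _ A(3)] by (auto simp: A(1))
      then show "\<phi> \<in> (\<Union>u\<in>{u. nat_le u s \<and> nat_le u t}. U \<inter> germ_dom u)"
        using A(3) germ_eqE[of s \<phi> t] by blast
    next
      fix \<phi> assume "\<phi> \<in> (\<Union>u\<in>{u. nat_le u s \<and> nat_le u t}. U \<inter> germ_dom u)"
      then obtain u where u: "nat_le u s" "nat_le u t" "\<phi> \<in> U" "\<phi> \<in> germ_dom u" by auto
      show "\<phi> \<in> ?P s A"
        using nat_le_char(1)[OF u(1,4)] germ_eq[OF u(1,2,4)] u(3) by (auto simp: A(1) slice_def)
    qed
    moreover have "openin chars_top (\<Union>u\<in>{u. nat_le u s \<and> nat_le u t}. U \<inter> germ_dom u)"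
      using A(2) clopen_chars_at(1)[OF star_mult_idems(1)] by auto
    ultimately show ?case by simp
  qed
  then show "W \<subseteq> arrows universal_groupoid \<and> (\<forall>s. openin chars_top (?P s W))"
    using openin_subset[OF W] by blast
next
  assume W: "W \<subseteq> arrows universal_groupoid \<and> (\<forall>s. openin chars_top (?P s W))"
  have eq: "W = (\<Union>s. slice s (?P s W))"
  proof (intro equalityI subsetI)
    fix x assume "x \<in> W"
    moreover from this obtain s \<phi> where "x = germ s \<phi>" "\<phi> \<in> germ_dom s"
      using W by (blast elim: arrowsE)
    ultimately show "x \<in> (\<Union>s. slice s (?P s W))" by (auto simp: slice_def)
  qed (auto simp: slice_def)
  have "openin (arr_top universal_groupoid) (slice s (?P s W))" for s
    unfolding universal_groupoid_def top_groupoid.simps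
    by (rule topology_generated_by_Basis) (use W in blast)
  then show "openin (arr_top universal_groupoid) W"
    by (subst eq) (rule openin_Union, elim rangeE, simp)
qed

lemma openin_slice:
  assumes "openin chars_top U" "U \<subseteq> germ_dom s"
  shows "openin (arr_top universal_groupoid) (slice s U)"
  unfolding universal_groupoid_def top_groupoid.simps
  by (rule topology_generated_by_Basis) (use assms in blast)

lemma openin_full_slice: "openin (arr_top universal_groupoid) (full_slice s)"
  by (simp add: openin_slice clopen_chars_at star_mult_idems)

text \<open>The inverse of the source map on a slice; it transports compact sets of characters to
  compact sets of arrows.\<close>

lemma continuous_map_germ:
  "continuous_map (subtopology chars_top (germ_dom s)) (arr_top universal_groupoid) (germ s)"
  unfolding continuous_map
proof (intro conjI allI impI)
  show "germ s ` topspace (subtopology chars_top (germ_dom s)) \<subseteq> arrows universal_groupoid"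
    by (auto simp: germ_in_arrows)
  fix W :: "('a \<times> ('a \<Rightarrow> bool)) set set" assume "openin (arr_top universal_groupoid) W"
  then have "openin chars_top {\<phi> \<in> germ_dom s. germ s \<phi> \<in> W}"
    by (simp add: openin_arr_top_iff)
  moreover have "{\<phi> \<in> topspace (subtopology chars_top (germ_dom s)). germ s \<phi> \<in> W}
      = {\<phi> \<in> germ_dom s. germ s \<phi> \<in> W} \<inter> germ_dom s"
    by (auto simp: topspace_chars_top chars_at_def)
  ultimately show "openin (subtopology chars_top (germ_dom s))
      {\<phi> \<in> topspace (subtopology chars_top (germ_dom s)). germ s \<phi> \<in> W}"
    unfolding openin_subtopology by blast
qed

lemma compactin_slice:
  assumes "compactin chars_top K" "K \<subseteq> germ_dom s"
  shows "compactin (arr_top universal_groupoid) (slice s K)"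
proof -
  have "slice s K = germ s ` K" by (auto simp: slice_def)
  then show ?thesis
    using image_compactin[OF _ continuous_map_germ, of s K] assms by (simp add: compactin_subtopology)
qed

lemma compactin_full_slice: "compactin (arr_top universal_groupoid) (full_slice s)"
  by (rule compactin_slice) (simp_all add: compactin_chars_at star_mult_idems)

lemma continuous_map_src: "continuous_map (arr_top universal_groupoid) chars_top (src universal_groupoid)"
  unfolding continuous_map
proof (intro conjI allI impI)
  show "src universal_groupoid ` arrows universal_groupoid \<subseteq> topspace chars_top"
    by (auto simp: topspace_chars_top src_germ chars_at_def elim!: arrowsE)
  fix U :: "('a \<Rightarrow> bool) set" assume U: "openin chars_top U"
  have "{\<phi> \<in> germ_dom s. germ s \<phi> \<in> {x \<in> arrows universal_groupoid. src universal_groupoid x \<in> U}}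
      = germ_dom s \<inter> U" for s
    by (auto simp: src_germ germ_in_arrows)
  then show "openin (arr_top universal_groupoid) {x \<in> arrows universal_groupoid. src universal_groupoid x \<in> U}"
    unfolding openin_arr_top_iff using U clopen_chars_at(1)[OF star_mult_idems(1)] by auto
qed

text \<open>On a slice the source map is continuous and injective into a Hausdorff space. The
  groupoid as a whole may fail to be Hausdorff.\<close>

lemma Hausdorff_full_slice: "Hausdorff_space (subtopology (arr_top universal_groupoid) (full_slice s))"
proof (rule Hausdorff_space_injective_preimage[OF Hausdorff_chars_top])
  show "continuous_map (subtopology (arr_top universal_groupoid) (full_slice s)) chars_top (src universal_groupoid)"
    by (rule continuous_map_from_subtopology[OF continuous_map_src])
  show "inj_on (src universal_groupoid) (topspace (subtopology (arr_top universal_groupoid) (full_slice s)))"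
    by (auto simp: inj_on_def slice_def src_germ)
qed

section \<open>Surjectivity\<close>

lemma range_sa_to_groupoid_ops:
  fixes g h :: "('s::inverse_semigroup \<times> ('s \<Rightarrow> bool)) set \<Rightarrow> 'k::comm_ring_1"
  assumes "g \<in> range sa_to_groupoid"
  shows range_sa_to_groupoid_add: "h \<in> range sa_to_groupoid \<Longrightarrow> g + h \<in> range sa_to_groupoid"
    and range_sa_to_groupoid_scale: "fun_scale c g \<in> range sa_to_groupoid"
    and range_sa_to_groupoid_diff: "h \<in> range sa_to_groupoid \<Longrightarrow> g - h \<in> range sa_to_groupoid"
proof -
  have *: "sa_to_groupoid (a - b) = sa_to_groupoid a - sa_to_groupoid b" for a b :: "'s \<Rightarrow>\<^sub>0 'k"
    by (rule module_hom.diff[OF module_hom_sa_to_groupoid])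
  show "h \<in> range sa_to_groupoid \<Longrightarrow> g + h \<in> range sa_to_groupoid"
    using assms by (auto simp flip: sa_to_groupoid_add)
  show "fun_scale c g \<in> range sa_to_groupoid"
    using assms by (auto simp flip: sa_to_groupoid_scale)
  show "h \<in> range sa_to_groupoid \<Longrightarrow> g - h \<in> range sa_to_groupoid"
    using assms by (auto simp flip: *)
qed

lemma indicator_full_slice_in_range:
  "indicator (full_slice s) \<in> range (sa_to_groupoid :: ('s::inverse_semigroup \<Rightarrow>\<^sub>0 'k::comm_ring_1) \<Rightarrow> _)"
proof -
  have "indicator (full_slice s) = (sa_to_groupoid (Poly_Mapping.single s 1) :: _ \<Rightarrow> 'k)"
    by (simp add: fun_eq_iff sa_to_groupoid_single)
  then show ?thesis by blast
qed

section \<open>Multipliers of the image along the source map\<close>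

definition restrict_src :: "('s::inverse_semigroup \<Rightarrow> bool) set \<Rightarrow>
    (('s \<times> ('s \<Rightarrow> bool)) set \<Rightarrow> 'k::comm_ring_1) \<Rightarrow> ('s \<times> ('s \<Rightarrow> bool)) set \<Rightarrow> 'k" where
  "restrict_src U g = (\<lambda>x. indicator U (src universal_groupoid x) * g x)"

text \<open>Members are sets of arbitrary functions and not only of characters, so that complements
  are taken in the whole type; topological statements about them concern their intersection with
  \<open>chars\<close>. The \<open>itself\<close> argument fixes the coefficient ring, which the
  type of the sets does not mention.\<close>

definition range_multipliers :: "'k::comm_ring_1 itself \<Rightarrow> ('s::inverse_semigroup \<Rightarrow> bool) set set" where
  "range_multipliers k = {U. \<forall>g \<in> range (sa_to_groupoid :: ('s \<Rightarrow>\<^sub>0 'k) \<Rightarrow> _).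
     restrict_src U g \<in> range sa_to_groupoid}"

lemma range_multipliers_UNIV: "UNIV \<in> range_multipliers k"
  by (simp add: range_multipliers_def restrict_src_def)

lemma range_multipliers_Int:
  assumes "U \<in> range_multipliers k" "V \<in> range_multipliers k"
  shows "U \<inter> V \<in> range_multipliers k"
proof -
  have *: "restrict_src (U \<inter> V) g = restrict_src U (restrict_src V g)" for g :: "_ \<Rightarrow> 'b"
    by (auto simp: restrict_src_def fun_eq_iff indicator_def)
  show ?thesis using assms unfolding range_multipliers_def mem_Collect_eq * by blast
qed

lemma range_multipliers_Compl:
  assumes "U \<in> range_multipliers k"
  shows "- U \<in> range_multipliers k"
proof -
  have *: "restrict_src (- U) g = g - restrict_src U g" for g :: "_ \<Rightarrow> 'b"
    by (auto simp: restrict_src_def fun_eq_iff indicator_def)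
  show ?thesis
    using assms unfolding range_multipliers_def mem_Collect_eq * by (blast intro: range_sa_to_groupoid_diff)
qed

lemma range_multipliers_Un:
  assumes "U \<in> range_multipliers k" "V \<in> range_multipliers k"
  shows "U \<union> V \<in> range_multipliers k"
  using range_multipliers_Compl[OF range_multipliers_Int[OF assms[THEN range_multipliers_Compl]]] by simp

lemma range_multipliers_finite_Union:
  assumes "finite \<U>" "\<U> \<subseteq> range_multipliers k"
  shows "\<Union>\<U> \<in> range_multipliers k"
  using assms
proof induction
  case empty
  then show ?case using range_multipliers_Compl[OF range_multipliers_UNIV] by simp
qed (auto intro: range_multipliers_Un)

text \<open>Right multiplication by \<open>e\<close> cuts the domain down to
  \<open>chars_at e\<close> and keeps the germs, so restricting sources becomes an operation in the
  semigroup.\<close>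

lemma full_slice_mult_idem:
  assumes "e \<in> idems"
  shows "x \<in> full_slice (s * e) \<longleftrightarrow> x \<in> full_slice s \<and> src universal_groupoid x \<in> chars_at e"
proof
  assume "x \<in> full_slice (s * e)"
  then obtain \<phi> where "x = germ (s * e) \<phi>" "\<phi> \<in> germ_dom (s * e)" by (auto simp: slice_def)
  then show "x \<in> full_slice s \<and> src universal_groupoid x \<in> chars_at e"
    using germ_mult_idem[OF assms] germ_dom_mult_idem[OF assms] by (auto simp: src_germ slice_def)
next
  assume "x \<in> full_slice s \<and> src universal_groupoid x \<in> chars_at e"
  then obtain \<phi> where \<phi>: "x = germ s \<phi>" "\<phi> \<in> germ_dom (s * e)"
    by (auto simp: slice_def src_germ germ_dom_mult_idem[OF assms])
  then show "x \<in> full_slice (s * e)"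
    using germ_mult_idem[OF assms \<phi>(2)] by (auto simp: slice_def)
qed

text \<open>Restricting sources to \<open>chars_at e\<close> corresponds in the semigroup algebra to
  right multiplication by the point mass at \<open>e\<close>; the preimage is written out as the
  resulting sum.\<close>

lemma range_multipliers_chars_at:
  fixes e :: "'s::inverse_semigroup"
  assumes "e \<in> idems"
  shows "chars_at e \<in> range_multipliers (k :: 'k::comm_ring_1 itself)"
proof -
  have "restrict_src (chars_at e) (sa_to_groupoid a) \<in> range (sa_to_groupoid :: ('s \<Rightarrow>\<^sub>0 'k) \<Rightarrow> _)"
    for a
  proof -
    have "restrict_src (chars_at e) (sa_to_groupoid a) x
        = sa_to_groupoid (\<Sum>s\<in>Poly_Mapping.keys a. Poly_Mapping.single (s * e) (Poly_Mapping.lookup a s)) x" for x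
      unfolding sa_to_groupoid_sum sum_fun_apply sa_to_groupoid_single restrict_src_def
      by (simp add: sa_to_groupoid_def sum_distrib_left)
        (auto simp: indicator_def full_slice_mult_idem[OF assms] intro!: sum.cong)
    then have "restrict_src (chars_at e) (sa_to_groupoid a)
        = sa_to_groupoid (\<Sum>s\<in>Poly_Mapping.keys a. Poly_Mapping.single (s * e) (Poly_Mapping.lookup a s))"
      by blast
    then show ?thesis by blast
  qed
  then show ?thesis by (auto simp: range_multipliers_def)
qed

text \<open>A neighbourhood of \<open>\<phi>\<close> is refined by finitely many conditions
  \<open>\<psi> e = \<phi> e\<close>, each of which cuts out \<open>chars_at e\<close> or its
  complement. Both are clopen among the characters and both are multipliers.\<close>

lemma chars_top_clopen_basis:
  assumes "openin chars_top U" "\<phi> \<in> U"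
  obtains V where "V \<in> range_multipliers (k :: 'k::comm_ring_1 itself)"
    "openin chars_top (V \<inter> chars)" "closedin chars_top (V \<inter> chars)" "\<phi> \<in> V" "V \<inter> chars \<subseteq> U"
proof -
  obtain Q where Q: "finite Q" "Q \<subseteq> idems" "{\<psi> \<in> chars. \<forall>e\<in>Q. \<psi> e = \<phi> e} \<subseteq> U"
    using chars_top_basis[OF assms] .
  define D where "D e = (if \<phi> e then chars_at e else - chars_at e)" for e
  have \<phi>: "\<phi> \<in> chars" using openin_subset[OF assms(1)] assms(2) by (auto simp: topspace_chars_top)
  have D: "D e \<in> range_multipliers k" "openin chars_top (D e \<inter> chars)" "closedin chars_top (D e \<inter> chars)"
    if "e \<in> idems" for e
  proof -
    note c = clopen_chars_at[OF that]
    have "chars_at e \<inter> chars = chars_at e" "- chars_at e \<inter> chars = topspace chars_top - chars_at e"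
      by (auto simp: topspace_chars_top chars_at_def)
    then show "D e \<in> range_multipliers k" "openin chars_top (D e \<inter> chars)" "closedin chars_top (D e \<inter> chars)"
      using c by (auto simp: D_def intro: range_multipliers_chars_at range_multipliers_Compl that)
  qed
  have "(\<Inter>e\<in>Q. D e) \<in> range_multipliers k \<and> openin chars_top ((\<Inter>e\<in>Q. D e) \<inter> chars)
      \<and> closedin chars_top ((\<Inter>e\<in>Q. D e) \<inter> chars)"
    using Q(1,2)
  proof induction
    case empty
    then show ?case by (simp add: range_multipliers_UNIV flip: topspace_chars_top)
  next
    case (insert e Q)
    have *: "(\<Inter>e\<in>insert e Q. D e) \<inter> chars = (D e \<inter> chars) \<inter> ((\<Inter>e\<in>Q. D e) \<inter> chars)" by auto
    show ?case
      unfolding * using insert D[of e]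
      by (simp add: range_multipliers_Int openin_Int closedin_Int)
  qed
  moreover have "\<phi> \<in> (\<Inter>e\<in>Q. D e)" using \<phi> by (auto simp: D_def chars_at_def)
  moreover have "(\<Inter>e\<in>Q. D e) \<inter> chars \<subseteq> U"
    using Q(3) by (auto simp: D_def chars_at_def split: if_splits)
  ultimately show ?thesis using that by blast
qed

text \<open>The source map turns \<open>W\<close> into a compact open set \<open>?K\<close> of
  characters. Finitely many multipliers, whose characters all lie in \<open>?K\<close>, cover it;
  restricting the indicator of the slice to their union gives the indicator of
  \<open>W\<close>.\<close>

lemma indicator_compact_open_in_range:
  assumes "openin (arr_top universal_groupoid) W" "compactin (arr_top universal_groupoid) W" "W \<subseteq> full_slice s"
  shows "indicator W \<in> range (sa_to_groupoid :: ('s::inverse_semigroup \<Rightarrow>\<^sub>0 'k::comm_ring_1) \<Rightarrow> _)"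
proof -
  let ?K = "{\<phi> \<in> germ_dom s. germ s \<phi> \<in> W}"
  have K: "openin chars_top ?K" using assms(1) by (simp add: openin_arr_top_iff)
  have "?K = src universal_groupoid ` W"
  proof (intro equalityI subsetI)
    fix \<phi> assume "\<phi> \<in> src universal_groupoid ` W"
    then obtain x where x: "x \<in> W" "\<phi> = src universal_groupoid x" by auto
    with assms(3) show "\<phi> \<in> ?K" by (auto simp: slice_def src_germ)
  qed (auto simp: src_germ intro!: rev_image_eqI)
  then have cK: "compactin chars_top ?K"
    using image_compactin[OF assms(2) continuous_map_src] by simp
  let ?\<U> = "{V \<in> range_multipliers TYPE('k). openin chars_top (V \<inter> chars) \<and> V \<inter> chars \<subseteq> ?K}"
  have "\<exists>\<F>. finite \<F> \<and> \<F> \<subseteq> (\<lambda>V. V \<inter> chars) ` ?\<U> \<and> ?K \<subseteq> \<Union>\<F>"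
  proof (rule compactinD[OF cK])
    show "?K \<subseteq> \<Union> ((\<lambda>V. V \<inter> chars) ` ?\<U>)"
    proof
      fix \<phi> assume \<phi>: "\<phi> \<in> ?K"
      obtain V where "V \<in> range_multipliers TYPE('k)" "openin chars_top (V \<inter> chars)" "\<phi> \<in> V" "V \<inter> chars \<subseteq> ?K"
        by (rule chars_top_clopen_basis[OF K \<phi>])
      moreover have "\<phi> \<in> chars" using \<phi> by (simp add: chars_at_def)
      ultimately show "\<phi> \<in> \<Union> ((\<lambda>V. V \<inter> chars) ` ?\<U>)" by blast
    qed
  qed auto
  then obtain \<V> where \<V>: "finite \<V>" "\<V> \<subseteq> ?\<U>" "?K \<subseteq> (\<Union>V\<in>\<V>. V \<inter> chars)"
    by (auto simp only: ex_finite_subset_image)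
  have "\<Union>\<V> \<in> range_multipliers TYPE('k)"
    using \<V> by (intro range_multipliers_finite_Union) auto
  then have "restrict_src (\<Union>\<V>) (indicator (full_slice s)) \<in> range (sa_to_groupoid :: ('s \<Rightarrow>\<^sub>0 'k) \<Rightarrow> _)"
    using indicator_full_slice_in_range unfolding range_multipliers_def by blast
  moreover have "restrict_src (\<Union>\<V>) (indicator (full_slice s)) = (indicator W :: _ \<Rightarrow> 'k)"
  proof
    fix x
    show "restrict_src (\<Union>\<V>) (indicator (full_slice s)) x = (indicator W x :: 'k)"
    proof (cases "x \<in> full_slice s")
      case True
      then obtain \<phi> where \<phi>: "x = germ s \<phi>" "\<phi> \<in> germ_dom s" by (auto simp: slice_def)
      have "\<phi> \<in> chars" using \<phi> by (simp add: chars_at_def)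
      \<comment> \<open>The union of \<open>\<V>\<close> may contain functions outside
        \<open>?K\<close>, but none of these is a character, and sources of arrows are
        characters.\<close>
      then have "\<phi> \<in> \<Union>\<V> \<longleftrightarrow> x \<in> W" using \<V>(2,3) \<phi> by blast
      then show ?thesis
        using True src_germ[OF \<phi>(2)] by (simp add: restrict_src_def indicator_def \<phi>(1))
    qed (use assms(3) in \<open>auto simp: restrict_src_def indicator_def\<close>)
  qed
  ultimately show ?thesis by simp
qed

text \<open>Disjointification: inside a Hausdorff open set the compact open slices are relatively closed,
  so the difference of two of them is again a compact open slice.\<close>

lemma groupoid_generator_in_range:
  assumes "f \<in> groupoid_generators universal_groupoid"
  shows "f \<in> range (sa_to_groupoid :: ('s::inverse_semigroup \<Rightarrow>\<^sub>0 'k::comm_ring_1) \<Rightarrow> _)"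
proof -
  let ?G = "universal_groupoid :: (('s \<times> ('s \<Rightarrow> bool)) set, 's \<Rightarrow> bool) top_groupoid"
  let ?T = "arr_top ?G"
  obtain V where V: "openin ?T V" "Hausdorff_space (subtopology ?T V)" "\<And>x. x \<notin> V \<Longrightarrow> f x = 0"
    "continuous_map (subtopology ?T V) (discrete_topology UNIV) f"
    "compactin (subtopology ?T V) (subtopology ?T V closure_of {x \<in> V. f x \<noteq> 0})"
    using assms unfolding groupoid_generators_def by blast
  have VT: "topspace (subtopology ?T V) = V"
    using openin_subset[OF V(1)] by auto
  \<comment> \<open>The coefficients are discrete, so the set where \<open>f\<close> is nonzero is
    closed in \<open>V\<close>; it therefore equals the support and is compact.\<close>
  have "closedin (subtopology ?T V) {x \<in> topspace (subtopology ?T V). f x \<in> - {0}}"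
    by (rule closedin_continuous_map_preimage[OF V(4)]) simp
  moreover have "{x \<in> topspace (subtopology ?T V). f x \<in> - {0}} = {x \<in> V. f x \<noteq> 0}"
    unfolding VT by auto
  ultimately have "subtopology ?T V closure_of {x \<in> V. f x \<noteq> 0} = {x \<in> V. f x \<noteq> 0}"
    by (simp add: closure_of_closedin)
  then have C: "compactin ?T {x \<in> V. f x \<noteq> 0}"
    using V(5) by (simp add: compactin_subtopology)
  have level: "openin ?T {y \<in> V. f y = c}" for c
  proof -
    have "openin (subtopology ?T V) {x \<in> topspace (subtopology ?T V). f x \<in> {c}}"
      by (rule openin_continuous_map_preimage[OF V(4)]) simp
    moreover have "{x \<in> topspace (subtopology ?T V). f x \<in> {c}} = {y \<in> V. f y = c}"
      unfolding VT by auto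
    ultimately show ?thesis using V(1) by (simp add: openin_open_subtopology)
  qed
  \<comment> \<open>The compact open pieces of slices inside \<open>V\<close> on which
    \<open>f\<close> is constant. They cover the support because \<open>f\<close> is locally
    constant on \<open>V\<close> and every character has small compact open neighbourhoods.\<close>
  define \<B> where "\<B> = {B. openin ?T B \<and> compactin ?T B \<and> B \<subseteq> V \<and> (\<exists>s. B \<subseteq> full_slice s) \<and> (\<exists>c. \<forall>x\<in>B. f x = c)}"
  have \<B>_open: "\<And>B. B \<in> \<B> \<Longrightarrow> openin ?T B" by (simp add: \<B>_def)
  have cover: "{x \<in> V. f x \<noteq> 0} \<subseteq> \<Union>\<B>"
  proof
    fix x assume x: "x \<in> {x \<in> V. f x \<noteq> 0}"
    then obtain s \<phi> where s: "x = germ s \<phi>" "\<phi> \<in> germ_dom s"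
      using openin_subset[OF V(1)] by (blast elim: arrowsE)
    let ?U = "{\<psi> \<in> germ_dom s. germ s \<psi> \<in> {y \<in> V. f y = f x}}"
    have "openin chars_top ?U" using level by (simp add: openin_arr_top_iff)
    moreover have "\<phi> \<in> ?U" using s x by simp
    ultimately obtain D where D: "openin chars_top (D \<inter> chars)" "closedin chars_top (D \<inter> chars)" "\<phi> \<in> D" "D \<inter> chars \<subseteq> ?U"
      by (rule chars_top_clopen_basis[where k = "TYPE('k)"])
    have "compactin chars_top (D \<inter> chars)"
      by (rule closed_compactin[OF compactin_chars_at[OF star_mult_idems(1)] _ D(2)]) (use D(4) in blast)
    then have "slice s (D \<inter> chars) \<in> \<B>"
      unfolding \<B>_def mem_Collect_eq using D(1,4)
      by (intro conjI exI[of _ s] exI[of _ "f x"] openin_slice compactin_slice) (auto simp: slice_def)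
    moreover have "x \<in> slice s (D \<inter> chars)"
      using s D(3) by (auto simp: slice_def chars_at_def)
    ultimately show "x \<in> \<Union>\<B>" by blast
  qed
  obtain \<F> where \<F>: "finite \<F>" "\<F> \<subseteq> \<B>" "{x \<in> V. f x \<noteq> 0} \<subseteq> \<Union>\<F>"
    using compactinD[OF C \<B>_open cover] by blast
  have "(\<lambda>x. f x * indicator (\<Union>\<F>) x) \<in> range (sa_to_groupoid :: ('s \<Rightarrow>\<^sub>0 'k) \<Rightarrow> _)"
    using \<F>(1,2)
  proof induction
    case empty
    have "(\<lambda>x. f x * indicator (\<Union>{}) x) = (sa_to_groupoid 0 :: _ \<Rightarrow> 'k)"
      unfolding sa_to_groupoid_zero by auto
    then show ?case by (rule range_eqI)
  next
    case (insert B \<F>)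
    have "B \<in> \<B>" using insert.prems by simp
    then obtain c s where B: "openin ?T B" "compactin ?T B" "B \<subseteq> V" "B \<subseteq> full_slice s" "\<And>x. x \<in> B \<Longrightarrow> f x = c"
      by (auto simp: \<B>_def)
    have "\<And>A. A \<in> \<F> \<Longrightarrow> openin ?T A \<and> compactin ?T A \<and> A \<subseteq> V"
      using insert.prems by (auto simp: \<B>_def)
    then have \<F>: "openin ?T (\<Union>\<F>)" "compactin ?T (\<Union>\<F>)" "\<Union>\<F> \<subseteq> V"
      using insert.hyps(1) by (simp_all add: openin_Union compactin_Union Sup_least)
    have "closedin (subtopology ?T V) (\<Union>\<F>)"
      by (rule compactin_imp_closedin[OF V(2)]) (use \<F> in \<open>simp add: compactin_subtopology\<close>)
    moreover have "closedin (subtopology ?T V) B"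
      by (rule compactin_imp_closedin[OF V(2)]) (use B in \<open>simp add: compactin_subtopology\<close>)
    moreover have "openin (subtopology ?T V) (\<Union>\<F>)" "openin (subtopology ?T V) B"
      using \<F> B V(1) by (simp_all add: openin_open_subtopology)
    ultimately have "openin (subtopology ?T V) (B - \<Union>\<F>)" "closedin (subtopology ?T V) (B - \<Union>\<F>)"
      by (simp_all add: openin_diff closedin_diff)
    moreover have "compactin (subtopology ?T V) B" using B by (simp add: compactin_subtopology)
    ultimately have "openin ?T (B - \<Union>\<F>)" "compactin ?T (B - \<Union>\<F>)"
      using V(1) closed_compactin[of "subtopology ?T V" B "B - \<Union>\<F>"]
      by (auto simp: openin_open_subtopology compactin_subtopology)
    then have "indicator (B - \<Union>\<F>) \<in> range (sa_to_groupoid :: ('s \<Rightarrow>\<^sub>0 'k) \<Rightarrow> _)"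
      by (rule indicator_compact_open_in_range) (use B(4) in blast)
    then have "(\<lambda>x. f x * indicator (\<Union>\<F>) x) + fun_scale c (indicator (B - \<Union>\<F>))
        \<in> range (sa_to_groupoid :: ('s \<Rightarrow>\<^sub>0 'k) \<Rightarrow> _)"
      using insert.IH insert.prems by (intro range_sa_to_groupoid_add range_sa_to_groupoid_scale) auto
    moreover have "(\<lambda>x. f x * indicator (\<Union>\<F>) x) + fun_scale c (indicator (B - \<Union>\<F>))
        = (\<lambda>x. f x * indicator (\<Union>(insert B \<F>)) x)"
      by (auto simp: fun_eq_iff fun_scale_def indicator_def B(5))
    ultimately show ?case by simp
  qed
  moreover have "(\<lambda>x. f x * indicator (\<Union>\<F>) x) = f"
    using \<F>(3) V(3) by (auto simp: fun_eq_iff indicator_def)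
  ultimately show ?thesis by simp
qed

text \<open>The slice itself serves as the Hausdorff open set: on it the function is constantly 1,
  and the support is the whole compact slice.\<close>

lemma indicator_full_slice_generator:
  "(indicator (full_slice s) :: _ \<Rightarrow> 'k::comm_ring_1) \<in> groupoid_generators universal_groupoid"
proof -
  let ?T = "arr_top (universal_groupoid :: (('a \<times> ('a \<Rightarrow> bool)) set, _) top_groupoid)"
  let ?V = "full_slice s"
  have VT: "topspace (subtopology ?T ?V) = ?V"
    using openin_subset[OF openin_full_slice] by auto
  have "continuous_map (subtopology ?T ?V) (discrete_topology UNIV) (indicator ?V :: _ \<Rightarrow> 'k)"
    by (rule continuous_map_eq[of _ _ "\<lambda>_. 1"]) (auto simp: VT)
  moreover have "subtopology ?T ?V closure_of {x \<in> ?V. (indicator ?V x :: 'k) \<noteq> 0} = ?V"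
    using closure_of_topspace[of "subtopology ?T ?V"] unfolding VT by (simp add: indicator_def)
  ultimately show ?thesis
    unfolding groupoid_generators_def
    using openin_full_slice Hausdorff_full_slice compactin_full_slice
    by (auto intro!: exI[of _ ?V] simp: compactin_subtopology)
qed

lemma range_sa_to_groupoid:
  "range (sa_to_groupoid :: ('s::inverse_semigroup \<Rightarrow>\<^sub>0 'k::comm_ring_1) \<Rightarrow> _) = groupoid_algebra universal_groupoid"
proof
  interpret module "fun_scale :: 'k \<Rightarrow> (('s \<times> ('s \<Rightarrow> bool)) set \<Rightarrow> 'k) \<Rightarrow> _"
    by (rule module_fun_scale)
  let ?R = "range (sa_to_groupoid :: ('s \<Rightarrow>\<^sub>0 'k) \<Rightarrow> _)"
  show "?R \<subseteq> groupoid_algebra universal_groupoid"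
  proof clarify
    fix a :: "'s \<Rightarrow>\<^sub>0 'k"
    have "sa_to_groupoid a = (\<Sum>s\<in>Poly_Mapping.keys a. fun_scale (Poly_Mapping.lookup a s) (indicator (full_slice s)))"
      by (simp add: fun_eq_iff sum_fun_apply sa_to_groupoid_def fun_scale_def)
    also have "\<dots> \<in> span (groupoid_generators universal_groupoid)"
      by (intro span_sum span_scale span_base indicator_full_slice_generator)
    finally show "sa_to_groupoid a \<in> groupoid_algebra universal_groupoid"
      by (simp add: groupoid_algebra_def)
  qed
  have "subspace (range (sa_to_groupoid :: ('s \<Rightarrow>\<^sub>0 'k) \<Rightarrow> _))"
    unfolding subspace_def
  proof (intro conjI ballI allI)
    show "0 \<in> ?R" using sa_to_groupoid_zero by (metis rangeI)
  qed (simp_all only: range_sa_to_groupoid_add range_sa_to_groupoid_scale)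
  then show "groupoid_algebra universal_groupoid \<subseteq> range (sa_to_groupoid :: ('s \<Rightarrow>\<^sub>0 'k) \<Rightarrow> _)"
    unfolding groupoid_algebra_def by (intro span_minimal subsetI groupoid_generator_in_range)
qed

lemma sa_groupoid_iso_sa_to_groupoid:
  "sa_groupoid_iso (sa_to_groupoid :: ('s::inverse_semigroup \<Rightarrow>\<^sub>0 'k::comm_ring_1) \<Rightarrow> _)"
  unfolding sa_groupoid_iso_def bij_betw_def
  using module_hom_sa_to_groupoid sa_to_groupoid_mult inj_sa_to_groupoid range_sa_to_groupoid by blast

section \<open>The center\<close>

text \<open>Equal germs have equal ranges, so both are composable with the same germ of
  \<open>s\<close>.\<close>

lemma germ_mult_cong_right:
  assumes "germ t \<phi> = germ t' \<phi>" "\<phi> \<in> germ_dom t" "\<phi> \<in> germ_dom t'" "act t \<phi> \<in> germ_dom s"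
  shows "germ (s * t) \<phi> = germ (s * t') \<phi>"
proof -
  have e: "act t \<phi> = act t' \<phi>"
    using rng_germ[OF assms(2)] rng_germ[OF assms(3)] assms(1) by simp
  have "gmul universal_groupoid (germ s (act t' \<phi>)) (germ t' \<phi>) = germ (s * t') \<phi>"
    by (rule gmul_germ[OF assms(3)]) (use assms(4) e in simp)
  then show ?thesis
    using gmul_germ[OF assms(2,4)] by (simp only: assms(1) e)
qed

lemma germ_idem_mult:
  assumes "e \<in> idems" "\<phi> \<in> germ_dom (e * s)"
  shows "germ (e * s) \<phi> = germ s \<phi>"
proof (rule germ_eq[OF nat_le_refl _ assms(2)])
  show "nat_le (e * s) s" using assms(1) by (auto simp: nat_le_def)
qed

text \<open>The companion of \<open>germ_mult_full_slice_iff\<close>: the germ of \<open>r\<close>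
  as a product of germs of \<open>s\<close> and \<open>t\<close> is solved for the right factor.
  Inverting the germ of \<open>s\<close> requires that \<open>act r \<phi>\<close> lie in the range
  of \<open>s\<close>, which is the domain of \<open>star s\<close>.\<close>

lemma germ_in_full_slice_mult_iff:
  assumes "\<phi> \<in> germ_dom r" "\<phi> \<in> germ_dom t"
  shows "germ r \<phi> \<in> full_slice (s * t)
    \<longleftrightarrow> act r \<phi> \<in> germ_dom (star s) \<and> germ t \<phi> = germ (star s * r) \<phi>"
proof -
  have c: "\<phi> \<in> chars" using assms by (simp add: chars_at_def)
  show ?thesis
  proof
    assume "germ r \<phi> \<in> full_slice (s * t)"
    then have st: "\<phi> \<in> germ_dom (s * t)" "germ r \<phi> = germ (s * t) \<phi>"
      using germ_in_slice_iff[OF assms(1), of "germ_dom (s * t)" "s * t"] by auto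
    have s: "act t \<phi> \<in> germ_dom s" using st(1) by (simp add: germ_dom_mult_iff[OF c])
    have "act r \<phi> = act s (act t \<phi>)"
      using rng_germ[OF assms(1)] rng_germ[OF st(1)] st(2) by (simp add: act_act)
    then have r: "act r \<phi> \<in> germ_dom (star s)" using act_mem_star[OF s] by simp
    have "germ (star s * r) \<phi> = germ (star s * (s * t)) \<phi>"
      by (rule germ_mult_cong_right[OF st(2) assms(1) st(1) r])
    also have "\<dots> = germ (star s * s * t) \<phi>" by (simp add: mult.assoc)
    also have "\<dots> = germ t \<phi>"
    proof (rule germ_idem_mult)
      show "\<phi> \<in> germ_dom (star s * s * t)"
        using s assms(2) by (simp add: germ_dom_mult_iff[OF c] chars_at_idem_dom star_mult_idems)
    qed (rule star_mult_idems)
    finally show "act r \<phi> \<in> germ_dom (star s) \<and> germ t \<phi> = germ (star s * r) \<phi>" using r by simp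
  next
    assume *: "act r \<phi> \<in> germ_dom (star s) \<and> germ t \<phi> = germ (star s * r) \<phi>"
    then have sr: "\<phi> \<in> germ_dom (star s * r)" using assms by (simp add: germ_dom_mult_iff[OF c])
    have "act t \<phi> = act (star s) (act r \<phi>)"
      using rng_germ[OF assms(2)] rng_germ[OF sr] * by (simp add: act_act)
    then have t: "act t \<phi> \<in> germ_dom s"
      using act_mem_star[of "act r \<phi>" "star s"] * by (simp add: star_star)
    have "germ (s * t) \<phi> = germ (s * (star s * r)) \<phi>"
      by (rule germ_mult_cong_right[OF conjunct2[OF *] assms(2) sr t])
    also have "\<dots> = germ (s * star s * r) \<phi>" by (simp add: mult.assoc)
    also have "\<dots> = germ r \<phi>"
    proof (rule germ_idem_mult)
      show "\<phi> \<in> germ_dom (s * star s * r)"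
        using * assms(1)
        by (simp add: germ_dom_mult_iff[OF c] chars_at_idem_dom star_mult_idems star_star)
    qed (rule star_mult_idems)
    finally have "germ r \<phi> = germ (s * t) \<phi>" ..
    moreover have "\<phi> \<in> germ_dom (s * t)"
      using t assms(2) by (simp add: germ_dom_mult_iff[OF c])
    ultimately show "germ r \<phi> \<in> full_slice (s * t)"
      by (auto simp: slice_def)
  qed
qed

section \<open>Convolution with point masses as translation of arrows\<close>

lemma convolution_single_right:
  assumes "\<phi> \<in> germ_dom r"
  shows "convolution universal_groupoid f (sa_to_groupoid (Poly_Mapping.single s c)) (germ r \<phi>)
    = (if \<phi> \<in> germ_dom s then f (germ (r * star s) (act s \<phi>)) * c else 0)"
\<comment> \<open>With a zero coefficient the point mass has empty support, so the key set is
  \<open>{s}\<close> only in the other case.\<close>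
proof (cases "c = 0")
  case False
  then have "{t \<in> Poly_Mapping.keys (Poly_Mapping.single s c). \<phi> \<in> germ_dom t}
      = (if \<phi> \<in> germ_dom s then {s} else {})"
    by auto
  then show ?thesis by (simp add: convolution_sa_to_groupoid_germ[OF assms])
qed (simp add: convolution_sa_to_groupoid_germ[OF assms])

text \<open>Here the arbitrary function is the right factor, so the formula over the keys of the
  right factor does not apply and the fibre sum is evaluated directly. By
  \<open>germ_in_full_slice_mult_iff\<close> the only arrow that can contribute is
  \<open>germ (star s * r) \<phi>\<close>.\<close>

lemma convolution_single_left:
  assumes "\<phi> \<in> germ_dom r"
  shows "convolution universal_groupoid (sa_to_groupoid (Poly_Mapping.single s c)) f (germ r \<phi>)
    = (if act r \<phi> \<in> germ_dom (star s) then c * f (germ (star s * r) \<phi>) else 0)"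
proof -
  let ?G = "universal_groupoid :: (('a \<times> ('a \<Rightarrow> bool)) set, 'a \<Rightarrow> bool) top_groupoid"
  let ?F = "sa_to_groupoid (Poly_Mapping.single s c)"
  let ?y = "germ (star s * r) \<phi>"
  have c: "\<phi> \<in> chars" using assms by (simp add: chars_at_def)
  have summand: "?F (gmul ?G (germ r \<phi>) (ginv ?G y)) * f y
      = (if act r \<phi> \<in> germ_dom (star s) \<and> y = ?y then c * f ?y else 0)"
    if y: "y \<in> arrows ?G" "src ?G y = \<phi>" for y
  proof -
    obtain t \<psi> where t: "y = germ t \<psi>" "\<psi> \<in> germ_dom t" using y(1) by (rule arrowsE)
    have "\<psi> = \<phi>" using y(2) src_germ[OF t(2)] t(1) by simp
    with t have t: "y = germ t \<phi>" "\<phi> \<in> germ_dom t" by simp_all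
    have "germ (r * star t) (act t \<phi>) \<in> full_slice s
        \<longleftrightarrow> act r \<phi> \<in> germ_dom (star s) \<and> germ t \<phi> = ?y"
      using germ_mult_full_slice_iff[OF assms t(2)] germ_in_full_slice_mult_iff[OF assms t(2)] by simp
    then show ?thesis
      unfolding t(1) gmul_ginv_germ[OF assms t(2)] sa_to_groupoid_single
      by (simp add: indicator_def)
  qed
  let ?Y = "{y \<in> arrows ?G. src ?G y = \<phi> \<and> ?F (gmul ?G (germ r \<phi>) (ginv ?G y)) * f y \<noteq> 0}"
  have conv: "convolution ?G ?F f (germ r \<phi>) = (\<Sum>y\<in>?Y. ?F (gmul ?G (germ r \<phi>) (ginv ?G y)) * f y)"
    unfolding convolution_def by (simp only: germ_in_arrows[OF assms] src_germ[OF assms] if_True)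
  have Y: "act r \<phi> \<in> germ_dom (star s) \<and> y = ?y" if "y \<in> ?Y" for y
  proof (rule ccontr)
    assume "\<not> ?thesis"
    with that summand[of y] show False by simp
  qed
  show ?thesis
  proof (cases "act r \<phi> \<in> germ_dom (star s)")
    case True
    then have d: "\<phi> \<in> germ_dom (star s * r)" using assms by (simp add: germ_dom_mult_iff[OF c])
    have "convolution ?G ?F f (germ r \<phi>) = (\<Sum>y\<in>{?y}. ?F (gmul ?G (germ r \<phi>) (ginv ?G y)) * f y)"
      unfolding conv
    proof (rule sum.mono_neutral_left)
      show "?Y \<subseteq> {?y}" using Y by blast
    qed (use germ_in_arrows[OF d] src_germ[OF d] in auto)
    then show ?thesis
      using True summand[OF germ_in_arrows[OF d] src_germ[OF d]] by simp
  next
    case False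
    then have "?Y = {}" using Y by blast
    then show ?thesis unfolding conv using False by (simp only: sum.empty if_False)
  qed
qed

text \<open>Together with its mirror image this reduces commuting with every element to commuting
  with point masses.\<close>

lemma sa_mult_expand_left:
  "a \<star> b = (\<Sum>s\<in>Poly_Mapping.keys a. Poly_Mapping.single s (Poly_Mapping.lookup a s) \<star> b)"
  unfolding sa_mult_def by (rule sum.cong) (simp_all add: in_keys_iff)

lemma sa_mult_expand_right:
  "a \<star> b = (\<Sum>t\<in>Poly_Mapping.keys b. a \<star> Poly_Mapping.single t (Poly_Mapping.lookup b t))"
  unfolding sa_mult_def by (subst sum.swap, rule sum.cong) (simp_all add: in_keys_iff)

text \<open>Only the point masses need to be tested; the two sides are the values of the convolutions
  with \<open>\<chi>\<close> of \<open>(s, D(s\<^sup>*s))\<close> at the germ \<open>[r, \<phi>]\<close>.\<close>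

lemma sa_center_iff:
  fixes z :: "'s::inverse_semigroup \<Rightarrow>\<^sub>0 'k::comm_ring_1"
  shows "z \<in> sa_center \<longleftrightarrow> (\<forall>r s \<phi>. \<phi> \<in> germ_dom r \<longrightarrow>
      (if \<phi> \<in> germ_dom s then sa_to_groupoid z (germ (r * star s) (act s \<phi>)) else 0)
      = (if act r \<phi> \<in> germ_dom (star s) then sa_to_groupoid z (germ (star s * r) \<phi>) else 0))"
    (is "_ \<longleftrightarrow> (\<forall>r s \<phi>. _ \<longrightarrow> ?R r s \<phi> = ?L r s \<phi>)")
proof
  let ?\<delta> = "\<lambda>s. Poly_Mapping.single s (1::'k)"
  assume z: "z \<in> sa_center"
  show "\<forall>r s \<phi>. \<phi> \<in> germ_dom r \<longrightarrow> ?R r s \<phi> = ?L r s \<phi>"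
  proof (intro allI impI)
    fix r s :: 's and \<phi>
    assume r: "\<phi> \<in> germ_dom r"
    have "convolution universal_groupoid (sa_to_groupoid z) (sa_to_groupoid (?\<delta> s))
        = convolution universal_groupoid (sa_to_groupoid (?\<delta> s)) (sa_to_groupoid z)"
      using z by (simp add: sa_center_def flip: sa_to_groupoid_mult)
    then have "convolution universal_groupoid (sa_to_groupoid z) (sa_to_groupoid (?\<delta> s)) (germ r \<phi>)
        = convolution universal_groupoid (sa_to_groupoid (?\<delta> s)) (sa_to_groupoid z) (germ r \<phi>)"
      by (rule fun_cong)
    then show "?R r s \<phi> = ?L r s \<phi>"
      by (simp only: convolution_single_left[OF r] convolution_single_right[OF r] mult_1 mult_1_right)
  qed
next
  assume eq: "\<forall>r s \<phi>. \<phi> \<in> germ_dom r \<longrightarrow> ?R r s \<phi> = ?L r s \<phi>"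
  have "z \<star> Poly_Mapping.single s c = Poly_Mapping.single s c \<star> z" for s c
  proof (rule injD[OF inj_sa_to_groupoid], unfold sa_to_groupoid_mult, rule ext)
    fix x :: "('s \<times> ('s \<Rightarrow> bool)) set"
    let ?F = "sa_to_groupoid (Poly_Mapping.single s c)"
    show "convolution universal_groupoid (sa_to_groupoid z) ?F x
        = convolution universal_groupoid ?F (sa_to_groupoid z) x"
    proof (cases "x \<in> arrows universal_groupoid")
      case True
      then obtain r \<phi> where x: "x = germ r \<phi>" "\<phi> \<in> germ_dom r" by (rule arrowsE)
      have "convolution universal_groupoid (sa_to_groupoid z) ?F x = c * ?R r s \<phi>"
        unfolding x(1) convolution_single_right[OF x(2)] by (simp add: mult.commute)
      also have "?R r s \<phi> = ?L r s \<phi>" using eq x(2) by blast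
      also have "c * ?L r s \<phi> = convolution universal_groupoid ?F (sa_to_groupoid z) x"
        unfolding x(1) convolution_single_left[OF x(2)] by simp
      finally show ?thesis .
    qed (simp add: convolution_def)
  qed
  then have "z \<star> a = a \<star> z" for a
    by (subst sa_mult_expand_left[of a z], subst sa_mult_expand_right[of z a]) simp
  then show "z \<in> sa_center" by (simp add: sa_center_def)
qed

lemma germ_dom_eq_chars_at_idem: "e \<in> idems \<Longrightarrow> germ_dom e = chars_at e"
  by (simp add: chars_at_idem_dom)

section \<open>Class functions and conjugation by germs\<close>

lemma conj_germ:
  assumes "\<phi> \<in> germ_dom s" "\<phi> \<in> germ_dom r" "act r \<phi> = \<phi>"
  shows "gmul universal_groupoid (gmul universal_groupoid (germ s \<phi>) (germ r \<phi>))
      (ginv universal_groupoid (germ s \<phi>)) = germ (s * r * star s) (act s \<phi>)"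
proof -
  have "\<phi> \<in> chars" using assms by (simp add: chars_at_def)
  then have "\<phi> \<in> germ_dom (s * r)" using assms by (simp add: germ_dom_mult_iff)
  moreover have "gmul universal_groupoid (germ s \<phi>) (germ r \<phi>) = germ (s * r) \<phi>"
    using gmul_germ[OF assms(2), of s] assms by simp
  ultimately show ?thesis by (simp add: gmul_ginv_germ assms(1))
qed

lemma class_function_isotropy:
  assumes "f \<in> class_functions universal_groupoid" "\<phi> \<in> germ_dom r" "f (germ r \<phi>) \<noteq> 0"
  shows "act r \<phi> = \<phi>"
proof -
  have "src universal_groupoid (germ r \<phi>) = rng universal_groupoid (germ r \<phi>)"
    using assms germ_in_arrows[OF assms(2)] unfolding class_functions_def by blast
  then show ?thesis by (simp add: src_germ[OF assms(2)] rng_germ[OF assms(2)])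
qed

lemma class_function_conj:
  assumes "f \<in> class_functions universal_groupoid"
    "\<phi> \<in> germ_dom s" "\<phi> \<in> germ_dom r" "act r \<phi> = \<phi>"
  shows "f (germ (s * r * star s) (act s \<phi>)) = f (germ r \<phi>)"
proof -
  let ?G = "universal_groupoid :: (('a \<times> ('a \<Rightarrow> bool)) set, 'a \<Rightarrow> bool) top_groupoid"
  have "\<forall>x\<in>arrows ?G. \<forall>z\<in>arrows ?G. src ?G x = rng ?G x \<and> rng ?G x = src ?G z
      \<longrightarrow> f (gmul ?G (gmul ?G z x) (ginv ?G z)) = f x"
    using assms(1) by (simp add: class_functions_def)
  from bspec[OF bspec[OF this germ_in_arrows[OF assms(3)]] germ_in_arrows[OF assms(2)]]
  show ?thesis
    by (simp add: src_germ[OF assms(2)] src_germ[OF assms(3)] rng_germ[OF assms(3)] assms(4)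
        conj_germ[OF assms(2,3,4)])
qed

lemma sa_to_groupoid_center:
  fixes z :: "'s::inverse_semigroup \<Rightarrow>\<^sub>0 'k::comm_ring_1"
  assumes "z \<in> sa_center"
  shows "sa_to_groupoid z \<in> class_functions universal_groupoid"
proof -
  let ?f = "sa_to_groupoid z"
  have eq: "(if \<phi> \<in> germ_dom s then ?f (germ (r * star s) (act s \<phi>)) else 0)
      = (if act r \<phi> \<in> germ_dom (star s) then ?f (germ (star s * r) \<phi>) else 0)"
    if "\<phi> \<in> germ_dom r" for r s \<phi>
    using assms that unfolding sa_center_iff by blast
  have isotropy: "act r \<phi> = \<phi>" if r: "\<phi> \<in> germ_dom r" and ne: "?f (germ r \<phi>) \<noteq> 0" for r \<phi>
  proof
    fix e
    have c: "\<phi> \<in> chars" "act r \<phi> \<in> chars" using r act_mem[OF r] by (simp_all add: chars_at_def)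
    show "act r \<phi> e = \<phi> e"
    proof (cases "e \<in> idems")
      case True
      then have ee: "e * e = e" by (simp add: idems_def)
      have 1: "?f (germ (r * e) (act e \<phi>)) = ?f (germ r \<phi>)" if "\<phi> \<in> chars_at e"
      proof -
        have "\<phi> \<in> germ_dom (r * e)" using r that by (simp add: germ_dom_mult_idem[OF True])
        then show ?thesis by (simp add: germ_mult_idem[OF True] act_idem[OF True that])
      qed
      have 2: "?f (germ (e * r) \<phi>) = ?f (germ r \<phi>)" if "act r \<phi> \<in> chars_at e"
      proof -
        have "\<phi> \<in> germ_dom (e * r)"
          using r that by (simp add: germ_dom_mult_iff[OF c(1)] germ_dom_eq_chars_at_idem[OF True])
        then show ?thesis by (simp add: germ_idem_mult[OF True])
      qed
      \<comment> \<open>Translating by an idempotent on either side leaves the germ unchanged, so a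
        nonzero value forces \<open>\<phi>\<close> and \<open>act r \<phi>\<close> to agree at
        \<open>e\<close>.\<close>
      have "(if \<phi> \<in> chars_at e then ?f (germ r \<phi>) else 0)
          = (if act r \<phi> \<in> chars_at e then ?f (germ r \<phi>) else 0)"
        using eq[OF r, of e] 1 2
        by (simp only: star_idem[OF True] ee cong: if_cong)
      then have "\<phi> \<in> chars_at e \<longleftrightarrow> act r \<phi> \<in> chars_at e"
        using ne by (simp split: if_splits)
      then show ?thesis using c by (simp add: chars_at_def)
    next
      case False
      then show ?thesis using c by (simp add: chars_def extensional_def)
    qed
  qed
  have invariant: "?f (germ (s * r * star s) (act s \<phi>)) = ?f (germ r \<phi>)"
    if s: "\<phi> \<in> germ_dom s" and r: "\<phi> \<in> germ_dom r" "act r \<phi> = \<phi>" for r s \<phi>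
  proof -
    have c: "\<phi> \<in> chars" using r by (simp add: chars_at_def)
    have sr: "\<phi> \<in> germ_dom (s * r)" using s r by (simp add: germ_dom_mult_iff[OF c])
    have "act (s * r) \<phi> = act s \<phi>" using r by (simp flip: act_act)
    \<comment> \<open>The centrality relation is applied at the germ of \<open>s * r\<close>: one
      translation by \<open>s\<close> produces the conjugate of \<open>r\<close>, the other leads
      back to \<open>r\<close>.\<close>
    then have "?f (germ (s * r * star s) (act s \<phi>)) = ?f (germ (star s * (s * r)) \<phi>)"
      using eq[OF sr, of s] s act_mem_star[OF s] by simp
    also have "germ (star s * (s * r)) \<phi> = germ (star s * s * r) \<phi>" by (simp add: mult.assoc)
    also have "\<dots> = germ r \<phi>"
      using r s
      by (intro germ_idem_mult) (simp_all add: star_mult_idems germ_dom_mult_iff[OF c] chars_at_idem_dom)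
    finally show ?thesis .
  qed
  show ?thesis
    unfolding class_functions_def mem_Collect_eq
  proof (intro conjI ballI impI)
    show "?f \<in> groupoid_algebra universal_groupoid" using range_sa_to_groupoid by blast
    fix x :: "('s \<times> ('s \<Rightarrow> bool)) set"
    assume "x \<in> arrows universal_groupoid"
    then obtain r \<phi> where r: "x = germ r \<phi>" "\<phi> \<in> germ_dom r" by (rule arrowsE)
    show "src universal_groupoid x = rng universal_groupoid x" if "?f x \<noteq> 0"
      using isotropy[OF r(2)] that by (simp add: r src_germ rng_germ)
    fix y :: "('s \<times> ('s \<Rightarrow> bool)) set"
    assume "y \<in> arrows universal_groupoid"
    then obtain s \<psi> where s: "y = germ s \<psi>" "\<psi> \<in> germ_dom s" by (rule arrowsE)
    assume "src universal_groupoid x = rng universal_groupoid x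
      \<and> rng universal_groupoid x = src universal_groupoid y"
    then have a: "act r \<phi> = \<phi>" and "\<psi> = \<phi>"
      using src_germ[OF r(2)] rng_germ[OF r(2)] src_germ[OF s(2)] unfolding r(1) s(1) by metis+
    then have s: "y = germ s \<phi>" "\<phi> \<in> germ_dom s" using s by simp_all
    show "?f (gmul universal_groupoid (gmul universal_groupoid y x) (ginv universal_groupoid y)) = ?f x"
      unfolding r(1) s(1) conj_germ[OF s(2) r(2) a] by (rule invariant[OF s(2) r(2) a])
  qed
qed

text \<open>A nonzero value of a class function forces isotropy, so both sides of
  \<open>sa_center_iff\<close> vanish unless \<open>\<phi>\<close> lies in the domain of
  \<open>s\<close> and \<open>r\<close> and \<open>s\<close> move it to the same point. In that case
  the two arguments are conjugate by the germ of \<open>s\<close>.\<close>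

lemma class_function_center:
  fixes z :: "'s::inverse_semigroup \<Rightarrow>\<^sub>0 'k::comm_ring_1"
  assumes "sa_to_groupoid z \<in> class_functions universal_groupoid"
  shows "z \<in> sa_center"
  unfolding sa_center_iff
proof (intro allI impI)
  let ?f = "sa_to_groupoid z"
  fix r s :: 's and \<phi>
  assume r: "\<phi> \<in> germ_dom r"
  have c: "\<phi> \<in> chars" using r by (simp add: chars_at_def)
  have right: "act r \<phi> = act s \<phi>"
    if s: "\<phi> \<in> germ_dom s" and ne: "?f (germ (r * star s) (act s \<phi>)) \<noteq> 0"
  proof -
    have "act s \<phi> \<in> chars" using act_mem[OF s] by (simp add: chars_at_def)
    then have "act s \<phi> \<in> germ_dom (r * star s)"
      using r s by (simp add: germ_dom_mult_iff act_star_act act_mem_star)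
    from class_function_isotropy[OF assms this ne]
    have "act r (act (star s) (act s \<phi>)) = act s \<phi>" by (simp only: act_act[of r "star s" "act s \<phi>"])
    then show ?thesis by (simp only: act_star_act[OF s])
  qed
  have left: "\<phi> \<in> germ_dom s" "act r \<phi> = act s \<phi>"
    if s: "act r \<phi> \<in> germ_dom (star s)" and ne: "?f (germ (star s * r) \<phi>) \<noteq> 0"
  proof -
    have "\<phi> \<in> germ_dom (star s * r)" using r s by (simp add: germ_dom_mult_iff[OF c])
    from class_function_isotropy[OF assms this ne] have *: "act (star s) (act r \<phi>) = \<phi>"
      by (simp add: act_act)
    show "\<phi> \<in> germ_dom s" using act_mem_star[OF s] by (simp add: * star_star)
    show "act r \<phi> = act s \<phi>" using act_star_act[OF s] by (simp add: * star_star)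
  qed
  have both: "?f (germ (r * star s) (act s \<phi>)) = ?f (germ (star s * r) \<phi>)"
    if s: "\<phi> \<in> germ_dom s" and e: "act r \<phi> = act s \<phi>"
  proof -
    have d: "\<phi> \<in> germ_dom (star s * r)"
      using r s e by (simp add: germ_dom_mult_iff[OF c] act_mem_star)
    have "act (star s) (act r \<phi>) = \<phi>" using e s by (simp add: act_star_act)
    then have a: "act (star s * r) \<phi> = \<phi>" by (simp add: act_act)
    have cs: "act s \<phi> \<in> chars" using act_mem[OF s] by (simp add: chars_at_def)
    have rs: "act s \<phi> \<in> germ_dom (r * star s)"
      using r s by (simp add: germ_dom_mult_iff[OF cs] act_star_act act_mem_star)
    have "act r (act (star s) (act s \<phi>)) = act s \<phi>" by (simp add: act_star_act[OF s] e)
    then have as: "act (r * star s) (act s \<phi>) = act s \<phi>" by (simp only: act_act[of r "star s" "act s \<phi>"])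
    \<comment> \<open>Conjugating \<open>star s * r\<close> by \<open>s\<close> gives
      \<open>r * star s\<close> up to the idempotent \<open>s * star s\<close>, which the germ
      absorbs.\<close>
    have "germ (s * (star s * r) * star s) (act s \<phi>) = germ (s * star s * (r * star s)) (act s \<phi>)"
      by (simp add: mult.assoc)
    also have "\<dots> = germ (r * star s) (act s \<phi>)"
    proof (rule germ_idem_mult)
      show "act s \<phi> \<in> germ_dom (s * star s * (r * star s))"
        using rs act_mem[OF s]
        by (simp add: germ_dom_mult_iff[OF cs, of "s * star s"] as germ_dom_eq_chars_at_idem star_mult_idems)
    qed (rule star_mult_idems)
    finally show ?thesis using class_function_conj[OF assms s d a] by simp
  qed
  show "(if \<phi> \<in> germ_dom s then ?f (germ (r * star s) (act s \<phi>)) else 0)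
      = (if act r \<phi> \<in> germ_dom (star s) then ?f (germ (star s * r) \<phi>) else 0)"
  proof (cases "\<phi> \<in> germ_dom s \<and> act r \<phi> = act s \<phi>")
    case True
    then have "act r \<phi> \<in> germ_dom (star s)" using act_mem_star[of \<phi> s] by simp
    then show ?thesis using True both by simp
  next
    case False
    then have "(if \<phi> \<in> germ_dom s then ?f (germ (r * star s) (act s \<phi>)) else 0) = 0"
      using right by (cases "\<phi> \<in> germ_dom s") auto
    moreover have "(if act r \<phi> \<in> germ_dom (star s) then ?f (germ (star s * r) \<phi>) else 0) = 0"
      using False left by (cases "act r \<phi> \<in> germ_dom (star s)") auto
    ultimately show ?thesis by simp
  qed
qed

lemma image_sa_center:
  "(sa_to_groupoid :: ('s::inverse_semigroup \<Rightarrow>\<^sub>0 'k::comm_ring_1) \<Rightarrow> _) ` sa_center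
    = class_functions universal_groupoid"
proof
  show "sa_to_groupoid ` sa_center \<subseteq> class_functions universal_groupoid"
    using sa_to_groupoid_center by blast
  show "class_functions universal_groupoid \<subseteq> (sa_to_groupoid :: ('s \<Rightarrow>\<^sub>0 'k) \<Rightarrow> _) ` sa_center"
  proof
    fix f :: "('s \<times> ('s \<Rightarrow> bool)) set \<Rightarrow> 'k" assume f: "f \<in> class_functions universal_groupoid"
    then have "f \<in> groupoid_algebra universal_groupoid" by (simp add: class_functions_def)
    then have "f \<in> range (sa_to_groupoid :: ('s \<Rightarrow>\<^sub>0 'k) \<Rightarrow> _)" by (simp add: range_sa_to_groupoid)
    then obtain z where z: "f = sa_to_groupoid (z :: 's \<Rightarrow>\<^sub>0 'k)" by (rule rangeE)
    then show "f \<in> sa_to_groupoid ` sa_center" using class_function_center f by blast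
  qed
qed

section \<open>The unit\<close>

text \<open>Germs of idempotents are the identity arrows, so this is the part of the unit space
  lying over \<open>U\<close>, seen as a set of arrows.\<close>

definition units_over :: "('s::inverse_semigroup \<Rightarrow> bool) set \<Rightarrow> ('s \<times> ('s \<Rightarrow> bool)) set set" where
  "units_over U = {x. src universal_groupoid x \<in> U \<and> (\<exists>e\<in>idems. x \<in> full_slice e)}"

text \<open>The product \<open>e * f\<close> is a common lower bound of \<open>e\<close> and
  \<open>f\<close>, and \<open>\<phi>\<close> lies in its domain.\<close>

lemma unit_germ_eq:
  assumes "e \<in> idems" "f \<in> idems" "\<phi> \<in> chars_at e" "\<phi> \<in> chars_at f"
  shows "germ e \<phi> = germ f \<phi>"
proof -
  have "\<phi> \<in> germ_dom (e * f)" "\<phi> \<in> germ_dom (f * e)"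
    using assms by (simp_all add: germ_dom_mult_idem germ_dom_eq_chars_at_idem)
  then show ?thesis
    using germ_mult_idem[of f \<phi> e] germ_mult_idem[of e \<phi> f] assms idems_commute[OF assms(1,2)] by simp
qed

lemma germ_in_units_over_iff:
  assumes "\<phi> \<in> germ_dom r" "e \<in> idems" "\<phi> \<in> chars_at e"
  shows "germ r \<phi> \<in> units_over U \<longleftrightarrow> \<phi> \<in> U \<and> germ r \<phi> = germ e \<phi>"
proof -
  have "germ r \<phi> \<in> full_slice f \<longleftrightarrow> \<phi> \<in> chars_at f \<and> germ r \<phi> = germ e \<phi>" if "f \<in> idems" for f
    using germ_in_slice_iff[OF assms(1), of "germ_dom f" f] unit_germ_eq[OF that assms(2) _ assms(3)]
    by (auto simp: germ_dom_eq_chars_at_idem that)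
  then show ?thesis
    unfolding units_over_def mem_Collect_eq src_germ[OF assms(1)] using assms(2,3) by blast
qed

text \<open>Outside \<open>U\<close>, the units over \<open>chars_at e\<close> form exactly the
  slice of \<open>e\<close>. Restricting that slice to \<open>- U\<close> makes the two sets of
  arrows disjoint, so that their indicators add up correctly in the coefficient ring.\<close>

lemma units_over_insert:
  assumes "e \<in> idems"
  shows "indicator (units_over (chars_at e \<union> U))
    = indicator (units_over U) + restrict_src (- U) (indicator (full_slice e) :: _ \<Rightarrow> 'k::comm_ring_1)"
proof
  fix x
  show "indicator (units_over (chars_at e \<union> U)) x
    = (indicator (units_over U) + restrict_src (- U) (indicator (full_slice e) :: _ \<Rightarrow> 'k)) x"
  proof (cases "src universal_groupoid x \<in> U")
    case True
    then show ?thesis by (simp add: units_over_def restrict_src_def indicator_def)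
  next
    case False
    have "x \<in> units_over (chars_at e \<union> U) \<longleftrightarrow> x \<in> full_slice e"
    proof
      assume "x \<in> units_over (chars_at e \<union> U)"
      then obtain f where f: "f \<in> idems" "x \<in> full_slice f" "src universal_groupoid x \<in> chars_at e"
        using False by (auto simp: units_over_def)
      then obtain \<phi> where \<phi>: "x = germ f \<phi>" "\<phi> \<in> germ_dom f" by (auto simp: slice_def)
      then have "\<phi> \<in> chars_at e" "\<phi> \<in> chars_at f"
        using f by (simp_all add: src_germ germ_dom_eq_chars_at_idem)
      then show "x \<in> full_slice e"
        unfolding slice_def germ_dom_eq_chars_at_idem[OF assms]
        using unit_germ_eq[OF f(1) assms] \<phi>(1) by blast
    next
      assume x: "x \<in> full_slice e"
      then obtain \<phi> where "x = germ e \<phi>" "\<phi> \<in> germ_dom e" by (auto simp: slice_def)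
      then have "src universal_groupoid x \<in> chars_at e"
        by (simp add: src_germ germ_dom_eq_chars_at_idem assms)
      with x show "x \<in> units_over (chars_at e \<union> U)"
        unfolding units_over_def using assms by blast
    qed
    moreover have "x \<notin> units_over U" using False by (simp add: units_over_def)
    ultimately show ?thesis using False by (simp add: restrict_src_def indicator_def)
  qed
qed

text \<open>Idempotents are added one at a time. Each correction term stays in the image because the
  finite union already treated, and hence its complement, is a multiplier.\<close>

lemma indicator_units_over_in_range:
  assumes "finite Q" "Q \<subseteq> idems"
  shows "indicator (units_over (\<Union>e\<in>Q. chars_at e))
    \<in> range (sa_to_groupoid :: ('s::inverse_semigroup \<Rightarrow>\<^sub>0 'k::comm_ring_1) \<Rightarrow> _)"
  using assms
proof induction
  case empty
  have "indicator (units_over (\<Union>e\<in>{}. chars_at e)) = (sa_to_groupoid (0 :: 's \<Rightarrow>\<^sub>0 'k) :: _ \<Rightarrow> 'k)"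
    by (simp add: sa_to_groupoid_zero units_over_def fun_eq_iff)
  then show ?case by (rule range_eqI)
next
  case (insert e Q)
  have "\<Union>(chars_at ` Q) \<in> range_multipliers TYPE('k)"
    using insert.hyps insert.prems
    by (intro range_multipliers_finite_Union) (auto intro: range_multipliers_chars_at)
  then have "restrict_src (- \<Union>(chars_at ` Q)) (indicator (full_slice e))
      \<in> range (sa_to_groupoid :: ('s \<Rightarrow>\<^sub>0 'k) \<Rightarrow> _)"
    using range_multipliers_Compl indicator_full_slice_in_range unfolding range_multipliers_def by blast
  moreover have "indicator (units_over (\<Union>(chars_at ` Q))) \<in> range (sa_to_groupoid :: ('s \<Rightarrow>\<^sub>0 'k) \<Rightarrow> _)"
    using insert by simp
  moreover have "e \<in> idems" using insert.prems by simp
  ultimately show ?case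
    by (simp only: image_insert Union_insert units_over_insert range_sa_to_groupoid_add)
qed

text \<open>The quotient of two germs at \<open>\<phi>\<close> is a unit exactly when the germs
  coincide, which turns the sum over keys into the defining sum of
  \<open>sa_to_groupoid a\<close>.\<close>

lemma convolution_units_left:
  fixes a :: "'s::inverse_semigroup \<Rightarrow>\<^sub>0 'k::comm_ring_1"
  shows "convolution universal_groupoid (indicator (units_over chars)) (sa_to_groupoid a) = sa_to_groupoid a"
proof
  fix x :: "('s \<times> ('s \<Rightarrow> bool)) set"
  show "convolution universal_groupoid (indicator (units_over chars)) (sa_to_groupoid a) x = sa_to_groupoid a x"
  proof (cases "x \<in> arrows universal_groupoid")
    case True
    then obtain r \<phi> where x: "x = germ r \<phi>" "\<phi> \<in> germ_dom r" by (rule arrowsE)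
    have *: "germ (r * star t) (act t \<phi>) \<in> units_over chars \<longleftrightarrow> germ r \<phi> \<in> full_slice t"
      if t: "\<phi> \<in> germ_dom t" for t
    proof -
      have ct: "act t \<phi> \<in> chars" using act_mem[OF t] by (simp add: chars_at_def)
      have d: "act t \<phi> \<in> germ_dom (r * star t)"
        using x(2) t by (simp add: germ_dom_mult_iff[OF ct] act_star_act act_mem_star)
      have "germ (r * star t) (act t \<phi>) \<in> units_over chars
          \<longleftrightarrow> germ (r * star t) (act t \<phi>) = germ (t * star t) (act t \<phi>)"
        using germ_in_units_over_iff[OF d star_mult_idems(2) act_mem[OF t]] ct by simp
      also have "\<dots> \<longleftrightarrow> germ (r * star t) (act t \<phi>) \<in> full_slice (t * star t)"
        using act_mem[OF t]
        by (simp add: germ_in_slice_iff[OF d] germ_dom_eq_chars_at_idem star_mult_idems)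
      also have "\<dots> \<longleftrightarrow> germ r \<phi> \<in> full_slice (t * star t * t)"
        by (rule germ_mult_full_slice_iff[OF x(2) t])
      finally show ?thesis by (simp only: star_props)
    qed
    have "sa_to_groupoid a x = (\<Sum>t | t \<in> Poly_Mapping.keys a \<and> \<phi> \<in> germ_dom t.
        Poly_Mapping.lookup a t * indicator (full_slice t) x)"
      unfolding sa_to_groupoid_def
      by (rule sum.mono_neutral_right) (auto simp: x(1) germ_in_slice_iff[OF x(2)] indicator_def)
    also have "\<dots> = convolution universal_groupoid (indicator (units_over chars)) (sa_to_groupoid a) x"
      unfolding x(1) convolution_sa_to_groupoid_germ[OF x(2)]
      by (rule sum.cong[OF refl]) (simp add: indicator_def *)
    finally show ?thesis by simp
  qed (simp add: convolution_def sa_to_groupoid_outside)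
qed

text \<open>The only unit with source \<open>\<phi>\<close> is the germ of
  \<open>star r * r\<close>, so at most one term of the fibre sum survives, and dividing by a unit
  returns the original arrow.\<close>

lemma convolution_units_right:
  fixes f :: "('s::inverse_semigroup \<times> ('s \<Rightarrow> bool)) set \<Rightarrow> 'k::comm_ring_1"
  assumes "\<phi> \<in> germ_dom r"
  shows "convolution universal_groupoid f (indicator (units_over chars)) (germ r \<phi>) = f (germ r \<phi>)"
proof -
  let ?G = "universal_groupoid :: (('s \<times> ('s \<Rightarrow> bool)) set, 's \<Rightarrow> bool) top_groupoid"
  let ?I = "indicator (units_over chars) :: _ \<Rightarrow> 'k"
  let ?e = "star r * r"
  have e: "?e \<in> idems" "\<phi> \<in> germ_dom ?e"
    using assms by (simp_all only: star_mult_idems germ_dom_eq_chars_at_idem)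
  have c: "\<phi> \<in> chars" using assms by (simp add: chars_at_def)
  let ?h = "\<lambda>y. f (gmul ?G (germ r \<phi>) (ginv ?G y)) * ?I y"
  have "convolution ?G f ?I (germ r \<phi>) = (\<Sum>y | y \<in> arrows ?G \<and> src ?G y = \<phi> \<and> ?h y \<noteq> 0. ?h y)"
    unfolding convolution_def by (simp only: germ_in_arrows[OF assms] src_germ[OF assms] if_True)
  also have "\<dots> = (\<Sum>y\<in>{germ ?e \<phi>}. ?h y)"
  proof (rule sum.mono_neutral_left)
    show "{y. y \<in> arrows ?G \<and> src ?G y = \<phi> \<and> ?h y \<noteq> 0} \<subseteq> {germ ?e \<phi>}"
    proof
      fix y assume y: "y \<in> {y. y \<in> arrows ?G \<and> src ?G y = \<phi> \<and> ?h y \<noteq> 0}"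
      then have "y \<in> arrows ?G" by blast
      then obtain t \<psi> where t: "y = germ t \<psi>" "\<psi> \<in> germ_dom t" by (rule arrowsE)
      have "\<psi> = \<phi>" using y src_germ[OF t(2)] t(1) by simp
      with t have t: "y = germ t \<phi>" "\<phi> \<in> germ_dom t" by simp_all
      have "y \<in> units_over chars"
      proof (rule ccontr)
        assume "y \<notin> units_over chars"
        then have "?h y = 0" by simp
        with y show False by blast
      qed
      then show "y \<in> {germ ?e \<phi>}"
        unfolding t(1) using germ_in_units_over_iff[OF t(2) e(1) assms] by simp
    qed
  qed (use germ_in_arrows[OF e(2)] src_germ[OF e(2)] in auto)
  also have "\<dots> = f (germ r \<phi>)"
  proof -
    have "germ ?e \<phi> \<in> units_over chars" using germ_in_units_over_iff[OF e(2,1) assms] c by simp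
    moreover have "gmul ?G (germ r \<phi>) (ginv ?G (germ ?e \<phi>)) = germ r \<phi>"
      using gmul_ginv_germ[OF assms e(2)]
      by (simp add: star_idem[OF e(1)] act_idem[OF e(1) assms] star_props flip: mult.assoc)
    ultimately show ?thesis by simp
  qed
  finally show ?thesis .
qed

text \<open>For a character \<open>\<phi>\<close> with \<open>\<phi> e\<close>, evaluate
  \<open>u \<star> ?\<delta> = ?\<delta>\<close> at the germ of \<open>e\<close>. The value 1 is
  nonzero, so some \<open>s\<close> in the support of \<open>u\<close> has \<open>\<phi>\<close> in
  the domain of \<open>s * e\<close>, hence in that of \<open>s\<close>.\<close>

lemma unit_imp_compact:
  fixes u :: "'s::inverse_semigroup \<Rightarrow>\<^sub>0 'k::comm_ring_1"
  assumes "\<And>a. u \<star> a = a"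
  shows "compact_space (chars_top :: ('s \<Rightarrow> bool) topology)"
proof -
  have "chars = (\<Union>t\<in>Poly_Mapping.keys u. germ_dom t)"
  proof (intro equalityI subsetI)
    fix \<phi> :: "'s \<Rightarrow> bool" assume \<phi>: "\<phi> \<in> chars"
    then obtain e where "e \<in> idems" "\<phi> e" unfolding chars_def by blast
    then have e: "e \<in> idems" "\<phi> \<in> germ_dom e"
      using \<phi> by (simp_all only: germ_dom_eq_chars_at_idem) (simp add: chars_at_def)
    let ?\<delta> = "Poly_Mapping.single e (1::'k)"
    have "(\<Sum>s\<in>Poly_Mapping.keys u. Poly_Mapping.lookup u s * indicator (full_slice (s * e)) (germ e \<phi>))
        = sa_to_groupoid (u \<star> ?\<delta>) (germ e \<phi>)"
      by (simp add: sa_to_groupoid_mult_apply)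
    also have "\<dots> = 1"
      by (simp add: assms sa_to_groupoid_single germ_in_slice_iff[OF e(2)] e(2))
    finally have sum: "(\<Sum>s\<in>Poly_Mapping.keys u.
        Poly_Mapping.lookup u s * indicator (full_slice (s * e)) (germ e \<phi>)) = 1" .
    have "\<exists>s\<in>Poly_Mapping.keys u. germ e \<phi> \<in> full_slice (s * e)"
    proof (rule ccontr)
      assume "\<not> ?thesis"
      then have "(\<Sum>s\<in>Poly_Mapping.keys u.
          Poly_Mapping.lookup u s * indicator (full_slice (s * e)) (germ e \<phi>)) = 0"
        by (intro sum.neutral) simp
      with sum show False by simp
    qed
    then show "\<phi> \<in> (\<Union>t\<in>Poly_Mapping.keys u. germ_dom t)"
      using germ_dom_mult_idem[OF e(1)] by (auto simp: germ_in_slice_iff[OF e(2)])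
  qed (auto simp: chars_at_def)
  moreover have "compactin chars_top (\<Union>t\<in>Poly_Mapping.keys u. germ_dom t)"
    by (rule compactin_Union) (auto simp: compactin_chars_at star_mult_idems)
  ultimately show ?thesis by (simp add: compact_space_def topspace_chars_top)
qed

lemma compact_imp_unit:
  assumes "compact_space (chars_top :: ('s::inverse_semigroup \<Rightarrow> bool) topology)"
  obtains u :: "'s::inverse_semigroup \<Rightarrow>\<^sub>0 'k::comm_ring_1" where "u \<noteq> 0" "\<And>a. u \<star> a = a" "\<And>a. a \<star> u = a"
proof -
  have "chars \<subseteq> (\<Union>e\<in>idems. chars_at e :: ('s \<Rightarrow> bool) set)"
    by (auto simp: chars_def chars_at_def)
  then have "\<exists>\<F>. finite \<F> \<and> \<F> \<subseteq> chars_at ` (idems :: 's set) \<and> chars \<subseteq> \<Union>\<F>"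
    using assms unfolding compact_space_def topspace_chars_top
    by (intro compactinD) (auto simp: clopen_chars_at)
  then obtain Q :: "'s set" where Q: "finite Q" "Q \<subseteq> idems" "chars \<subseteq> \<Union>(chars_at ` Q)"
    by (auto simp only: ex_finite_subset_image)
  then have "\<Union>(chars_at ` Q) = (chars :: ('s \<Rightarrow> bool) set)"
    by (intro equalityI) (auto simp: chars_at_def)
  then have "indicator (units_over chars) \<in> range (sa_to_groupoid :: ('s \<Rightarrow>\<^sub>0 'k) \<Rightarrow> _)"
    using indicator_units_over_in_range[OF Q(1,2)] by simp
  then obtain u :: "'s \<Rightarrow>\<^sub>0 'k" where u: "sa_to_groupoid u = indicator (units_over chars)"
    by (auto simp: image_iff)
  have left: "u \<star> a = a" for a
    by (rule injD[OF inj_sa_to_groupoid]) (simp only: sa_to_groupoid_mult u convolution_units_left)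
  have right: "a \<star> u = a" for a
  proof (rule injD[OF inj_sa_to_groupoid], rule ext)
    fix x :: "('s \<times> ('s \<Rightarrow> bool)) set"
    show "sa_to_groupoid (a \<star> u) x = sa_to_groupoid a x"
    proof (cases "x \<in> arrows universal_groupoid")
      case True
      then obtain r \<phi> where x: "x = germ r \<phi>" "\<phi> \<in> germ_dom r" by (rule arrowsE)
      show ?thesis
        by (simp only: x(1) sa_to_groupoid_mult u convolution_units_right[OF x(2)])
    qed (simp add: sa_to_groupoid_outside)
  qed
  \<comment> \<open>Here \<open>undefined\<close> is just some element of the semigroup: if
    \<open>u\<close> were zero, the point mass there would vanish, contradicting that 1 is nonzero
    in the coefficient ring.\<close>
  have "u \<noteq> 0"
  proof
    assume "u = 0"
    with left[of "Poly_Mapping.single undefined 1"]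
    have "Poly_Mapping.lookup (Poly_Mapping.single undefined 1 :: 's \<Rightarrow>\<^sub>0 'k) undefined = 0"
      by (simp add: sa_mult_def)
    then show False by simp
  qed
  then show ?thesis using that left right by blast
qed

text \<open>The condition \<open>u \<noteq> 0\<close> expresses the convention that rings with unit
  are non-zero, and the Hausdorff clause belongs to the meaning of compactness.\<close>

theorem corollary5p5:
  shows "((\<exists>u :: 's::inverse_semigroup \<Rightarrow>\<^sub>0 'k::comm_ring_1. u \<noteq> 0 \<and> (\<forall>a. u \<star> a = a \<and> a \<star> u = a))
           \<longleftrightarrow> compact_space (chars_top :: ('s \<Rightarrow> bool) topology)
               \<and> Hausdorff_space (chars_top :: ('s \<Rightarrow> bool) topology))
       \<and> sa_groupoid_iso (sa_to_groupoid :: ('s \<Rightarrow>\<^sub>0 'k) \<Rightarrow> _)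
       \<and> (sa_to_groupoid :: ('s \<Rightarrow>\<^sub>0 'k) \<Rightarrow> _) ` sa_center = class_functions universal_groupoid"
proof (intro conjI iffI)
  assume "\<exists>u :: 's \<Rightarrow>\<^sub>0 'k. u \<noteq> 0 \<and> (\<forall>a. u \<star> a = a \<and> a \<star> u = a)"
  then show "compact_space (chars_top :: ('s \<Rightarrow> bool) topology)"
    using unit_imp_compact by blast
next
  assume "compact_space (chars_top :: ('s \<Rightarrow> bool) topology)
    \<and> Hausdorff_space (chars_top :: ('s \<Rightarrow> bool) topology)"
  then obtain u :: "'s \<Rightarrow>\<^sub>0 'k" where "u \<noteq> 0" "\<And>a. u \<star> a = a" "\<And>a. a \<star> u = a"
    using compact_imp_unit by blast
  then show "\<exists>u :: 's \<Rightarrow>\<^sub>0 'k. u \<noteq> 0 \<and> (\<forall>a. u \<star> a = a \<and> a \<star> u = a)" by blast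
qed (rule Hausdorff_chars_top sa_groupoid_iso_sa_to_groupoid image_sa_center)+

end
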